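(* Let $T_1,\dots,T_d$ be $D\times D$ matrices defining an injective translation-invariant MPS. Then there is a representation of the MPS, a full-rank density matrix $\sigma\in\mathcal B(\mathbb{C}^D)$ with smallest eigenvalue $\sigma_{\min}$, positive constants $c,c'$ and $\gamma\in(0,1)$ such that the boundary state $\rho_{\partial A}$ (in this representation) of a chain $A$ of length $m$ satisfies $$\big\|\rho_{\partial A}^{1/2}(\sigma^{-1}\otimes\mathbb 1)\rho_{\partial A}^{1/2}-\mathbb 1\big\|\le c\,\sigma_{\min}^{-1}\gamma^m\quad\text{for all } m,$$ and $$\big\|\rho_{\partial A}^{-1/2}(\sigma\otimes\mathbb 1)\rho_{\partial A}^{-1/2}-\mathbb 1\big\|\le c'\,\sigma_{\min}^{-1}\gamma^m\quad\text{for all sufficiently large } m .$$ Here $\|\cdot\|$ is the operator norm.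
   Context: The translation-invariant MPS on a chain of length $N$ is $|\mathrm{MPS}\rangle=\sum_{j_1,\dots,j_N=1}^d\operatorname{tr}(T_{j_1}\cdots T_{j_N})|j_1,\dots,j_N\rangle$. It is injective if, for every chain length $m\ge 1$ (a standing assumption, achieved after blocking sites), the products $T_{j_1}\cdots T_{j_m}$, $j_i\in\{1,\dots,d\}$, span the full matrix algebra $\mathcal B(\mathbb{C}^D)$. A representation of the MPS is a choice of matrices obtained from $(T_j)$ by a change of gauge $T_j\mapsto \mu\,ZT_jZ^{-1}$ with $Z$ invertible and $\mu\neq0$ a scalar; this changes $|\mathrm{MPS}\rangle$ only by normalization. The transfer operator is $\mathbb E(f)=\sum_jT_jfT_j^\dagger$, and the boundary state of a chain $A$ of length $m$ is the Choi matrix $\rho_{\partial A}=(\mathbb E^m\otimes\mathrm{id})(|\Omega\rangle\langle\Omega|)$, with $|\Omega\rangle=\sum_{i=1}^D|i,i\rangle$. *)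

theory Defs
  imports "HOL-Analysis.Analysis"
begin

section \<open>Complex matrices\<close>

text \<open>
  The componentwise product \<open>*\<close> is not the matrix product, and the library's scalar
  multiplication \<open>*s\<close> is only the complex one for vectors, hence \<open>mat_scale\<close>.
\<close>

definition mat_scale :: "complex \<Rightarrow> complex^'n^'m \<Rightarrow> complex^'n^'m"
  where "mat_scale a A = map_matrix ((*) a) A"

global_interpretation cmat: vector_space "mat_scale :: complex \<Rightarrow> complex^'n^'m \<Rightarrow> complex^'n^'m"
  by standard (simp_all add: mat_scale_def vec_eq_iff algebra_simps)

definition dagger :: "complex^'n^'m \<Rightarrow> complex^'m^'n"
  where "dagger A = (\<chi> i j. cnj (A $ j $ i))"

text \<open>
  On \<open>complex^'n\<close> the library's real inner product \<open>v \<bullet> w\<close> is the real part of the Hermitian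
  inner product, and the latter is real for \<open>w = A *v v\<close> with \<open>A\<close> Hermitian.
\<close>

definition psd :: "complex^'n^'n \<Rightarrow> bool"
  where "psd A \<longleftrightarrow> dagger A = A \<and> (\<forall>v. 0 \<le> v \<bullet> (A *v v))"

definition density_matrix :: "complex^'n^'n \<Rightarrow> bool"
  where "density_matrix A \<longleftrightarrow> psd A \<and> trace A = 1"

text \<open>
  A positive semidefinite matrix has exactly one positive semidefinite square root, so for those
  the choice below is unambiguous.
\<close>

definition mat_sqrt :: "complex^'n^'n \<Rightarrow> complex^'n^'n"
  where "mat_sqrt A = (SOME B. psd B \<and> B ** B = A)"

definition eigenvalue :: "complex^'n^'n \<Rightarrow> complex \<Rightarrow> bool"
  where "eigenvalue A l \<longleftrightarrow> (\<exists>v. v \<noteq> 0 \<and> A *v v = l *s v)"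

text \<open>Intended for Hermitian matrices, all of whose eigenvalues are real.\<close>

definition min_eigenvalue :: "complex^'n^'n \<Rightarrow> real"
  where "min_eigenvalue A = Min {r. eigenvalue A (complex_of_real r)}"

definition opnorm :: "complex^'n^'m \<Rightarrow> real"
  where "opnorm A = onorm ((*v) A)"

definition kron :: "complex^'n^'m \<Rightarrow> complex^'q^'p \<Rightarrow> complex^('n \<times> 'q)^('m \<times> 'p)"
  where "kron A B = (\<chi> i j. A $ fst i $ fst j * B $ snd i $ snd j)"

text \<open>
  \<open>map_tensor_id \<Phi>\<close> is \<open>\<Phi> \<otimes> id\<close>: apply \<open>\<Phi>\<close> to every block of \<open>X\<close> that has fixed second
  tensor indices (see the lemma below).
\<close>

definition map_tensor_id ::
    "(complex^'n^'n \<Rightarrow> complex^'n^'n) \<Rightarrow> complex^('n \<times> 'k::finite)^('n \<times> 'k) \<Rightarrow> complex^('n \<times> 'k)^('n \<times> 'k)"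
  where "map_tensor_id \<Phi> X =
    (\<chi> p q. \<Phi> (\<chi> a b. X $ (a, snd p) $ (b, snd q)) $ fst p $ fst q)"

lemma map_tensor_id_kron:
  assumes "\<And>a A. \<Phi> (mat_scale a A) = mat_scale a (\<Phi> A)"
  shows "map_tensor_id \<Phi> (kron A B) = kron (\<Phi> A) B"
proof -
  have "(\<chi> a b. kron A B $ (a, i) $ (b, j)) = mat_scale (B $ i $ j) A" for i j
    by (simp add: kron_def mat_scale_def vec_eq_iff)
  then show ?thesis
    by (simp add: map_tensor_id_def assms) (simp add: kron_def mat_scale_def vec_eq_iff)
qed


section \<open>Matrix product states\<close>

definition mps_word :: "('d \<Rightarrow> complex^'n^'n) \<Rightarrow> 'd list \<Rightarrow> complex^'n^'n"
  where "mps_word T js = foldr (\<lambda>j A. T j ** A) js (mat 1)"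

definition mps_injective :: "('d::finite \<Rightarrow> complex^'n^'n) \<Rightarrow> bool"
  where "mps_injective T \<longleftrightarrow>
    (\<forall>m\<ge>1. cmat.span {mps_word T js | js. length js = m} = UNIV)"

definition mps_representation ::
    "('d::finite \<Rightarrow> complex^'n^'n) \<Rightarrow> ('d \<Rightarrow> complex^'n^'n) \<Rightarrow> bool"
  where "mps_representation T S \<longleftrightarrow>
    (\<exists>\<mu> Z. \<mu> \<noteq> 0 \<and> invertible Z \<and> (\<forall>j. S j = mat_scale \<mu> (Z ** T j ** matrix_inv Z)))"

definition transfer :: "('d::finite \<Rightarrow> complex^'n^'n) \<Rightarrow> complex^'n^'n \<Rightarrow> complex^'n^'n"
  where "transfer T f = (\<Sum>j\<in>UNIV. T j ** f ** dagger (T j))"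

definition Omega :: "complex^('n::finite \<times> 'n)"
  where "Omega = (\<chi> p. if fst p = snd p then 1 else 0)"

definition ket_bra :: "complex^'k \<Rightarrow> complex^'k^'k"
  where "ket_bra v = (\<chi> i j. v $ i * cnj (v $ j))"

definition boundary_state ::
    "('d::finite \<Rightarrow> complex^'n^'n) \<Rightarrow> nat \<Rightarrow> complex^('n \<times> 'n)^('n \<times> 'n)"
  where "boundary_state T m = map_tensor_id (transfer T ^^ m) (ket_bra Omega)"

end

theory Submission
  imports Defs
begin

text \<open>
  The matrices \<open>T\<^sub>j\<close> themselves span all matrices, so both the transfer operator and its dual map
  nonzero positive matrices to positive definite ones, and Brouwer's theorem on the density matrices
  yields positive definite eigenvectors. Conjugating by the square root of the dual eigenvector makes
  the transfer operator trace preserving. Doeblin's argument then gives \<open>E\<^sup>m(X) \<rightarrow> tr(X) \<sigma>\<close>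
  exponentially fast for every \<open>X\<close>, that is, \<open>\<rho>\<^sub>m \<rightarrow> \<Sigma> = \<sigma> \<otimes> 1\<close>. With \<open>B\<close> the square root of
  \<open>\<rho>\<^sub>m\<close>, the two claims follow from
  \<open>B \<Sigma>\<^sup>-\<^sup>1 B - 1 = B \<Sigma>\<^sup>-\<^sup>1 (\<rho>\<^sub>m - \<Sigma>) B\<^sup>-\<^sup>1\<close> and
  \<open>B\<^sup>-\<^sup>1 \<Sigma> B\<^sup>-\<^sup>1 - 1 = B\<^sup>-\<^sup>1 (\<Sigma> - \<rho>\<^sub>m) B\<^sup>-\<^sup>1\<close> once \<open>\<rho>\<^sub>m\<close> is uniformly positive definite.
\<close>

section \<open>Hermitian forms\<close>

lemma dagger_nth [simp]: "dagger A $ i $ j = cnj (A $ j $ i)"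
  by (simp add: dagger_def)

lemma mat_scale_nth [simp]: "mat_scale a A $ i $ j = a * A $ i $ j"
  by (simp add: mat_scale_def)

lemma dagger_dagger [simp]: "dagger (dagger A) = A"
  by (simp add: vec_eq_iff)

lemma dagger_mult: "dagger (A ** B) = dagger B ** dagger A"
  by (simp add: vec_eq_iff matrix_matrix_mult_def mult.commute)

lemma dagger_add: "dagger (A + B) = dagger A + dagger B"
  by (simp add: vec_eq_iff)

lemma dagger_diff: "dagger (A - B) = dagger A - dagger B"
  by (simp add: vec_eq_iff)

lemma dagger_scaleR: "dagger (r *\<^sub>R A) = r *\<^sub>R dagger A"
  by (simp add: vec_eq_iff)

lemma dagger_mat_1 [simp]: "dagger (mat 1) = mat 1"
  by (simp add: vec_eq_iff mat_def)

lemma dagger_mat_scale: "dagger (mat_scale a A) = mat_scale (cnj a) (dagger A)"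
  by (simp add: vec_eq_iff)

lemma dagger_sum: "dagger (\<Sum>i\<in>I. f i) = (\<Sum>i\<in>I. dagger (f i))"
  by (simp add: vec_eq_iff)

lemma mat_scale_mult_left: "mat_scale a A ** B = mat_scale a (A ** B)"
  by (simp add: vec_eq_iff matrix_matrix_mult_def sum_distrib_left mult.assoc)

lemma mat_scale_mult_right: "A ** mat_scale a B = mat_scale a (A ** B)"
  by (simp add: vec_eq_iff matrix_matrix_mult_def sum_distrib_left mult.left_commute)

lemma mat_scale_of_real: "mat_scale (of_real r) A = r *\<^sub>R A"
  by (simp add: vec_eq_iff scaleR_conv_of_real[where 'a = complex])

lemma mat_scale_mult_vec: "mat_scale a A *v v = a *s (A *v v)"
  by (simp add: vec_eq_iff matrix_vector_mult_def sum_distrib_left mult.assoc)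

lemma scaleR_mult_vec: "(r *\<^sub>R A) *v v = r *\<^sub>R (A *v (v::complex^'n))"
  by (simp add: vec_eq_iff matrix_vector_mult_def scaleR_sum_right)

lemma mult_vec_scaleR: "A *v (r *\<^sub>R v) = r *\<^sub>R (A *v (v::complex^'n))"
  by (simp add: vec_eq_iff matrix_vector_mult_def scaleR_sum_right)

lemma matrix_diff_left: "(A - B) ** C = A ** C - B ** (C :: complex^'n^'m)"
  by (simp add: vec_eq_iff matrix_matrix_mult_def algebra_simps sum_subtractf)

lemma matrix_diff_right: "C ** (A - B) = C ** A - C ** (B :: complex^'n^'m)"
  by (simp add: vec_eq_iff matrix_matrix_mult_def algebra_simps sum_subtractf)

lemma trace_mat_scale: "trace (mat_scale a A) = a * trace A"
  by (simp add: trace_def sum_distrib_left)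

lemma trace_scaleR: "trace (r *\<^sub>R A) = r *\<^sub>R trace (A :: complex^'n^'n)"
  by (simp add: trace_def scaleR_sum_right)

lemma trace_sum: "trace (\<Sum>i\<in>I. f i) = (\<Sum>i\<in>I. trace (f i :: complex^'n^'n))"
  by (simp add: trace_def sum.swap[of _ UNIV])

section \<open>Positive semidefinite matrices: forms, kernels and entries\<close>

lemma inner_dagger: "v \<bullet> (A *v w) = (dagger A *v v) \<bullet> (w :: complex^'n)"
proof -
  have eq: "x \<bullet> (a * y) = (cnj a * x) \<bullet> y" for x y a :: complex
    by (simp add: inner_complex_def algebra_simps)
  have "v \<bullet> (A *v w) = (\<Sum>i\<in>UNIV. \<Sum>j\<in>UNIV. (cnj (A $ i $ j) * v $ i) \<bullet> w $ j)"
    by (simp add: inner_vec_def matrix_vector_mult_def inner_sum_right eq)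
  also have "\<dots> = (\<Sum>j\<in>UNIV. \<Sum>i\<in>UNIV. (cnj (A $ i $ j) * v $ i) \<bullet> w $ j)"
    by (rule sum.swap)
  also have "\<dots> = (dagger A *v v) \<bullet> w"
    by (simp add: inner_vec_def matrix_vector_mult_def inner_sum_left)
  finally show ?thesis .
qed

lemma inner_hermitian: "dagger A = A \<Longrightarrow> v \<bullet> (A *v w) = (A *v v) \<bullet> w"
  by (metis inner_dagger)

lemma inner_congruence: "v \<bullet> ((B ** A ** dagger B) *v v) = (dagger B *v v) \<bullet> (A *v (dagger B *v v))"
  by (metis inner_dagger matrix_vector_mul_assoc)

text \<open>Moving from \<open>v\<close> to \<open>v - t *\<^sub>R w\<close> with
  \<open>w = A *v v\<close> makes the form a nonnegative quadratic polynomial in \<open>t\<close>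
  without constant term, so its linear coefficient, a multiple of \<open>w \<bullet> w\<close>, must
  vanish.\<close>

lemma psd_kernel:
  fixes A :: "complex^'n^'n"
  assumes "psd A" and zero: "v \<bullet> (A *v v) = 0"
  shows "A *v v = 0"
proof -
  define w where "w = A *v v"
  have A: "dagger A = A" and pos: "\<And>u. 0 \<le> u \<bullet> (A *v u)"
    using \<open>psd A\<close> by (auto simp: psd_def)
  define b where "b = w \<bullet> (A *v w)"
  have b: "b \<ge> 0" unfolding b_def by (rule pos)
  have vw: "v \<bullet> (A *v w) = w \<bullet> w"
    unfolding w_def using inner_hermitian[OF A] by blast
  have ineq: "2 * t * (w \<bullet> w) \<le> t\<^sup>2 * b" for t :: real
  proof -
    have "0 \<le> (v - t *\<^sub>R w) \<bullet> (A *v (v - t *\<^sub>R w))" by (rule pos)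
    also have "\<dots> = v \<bullet> (A *v v) - t * (v \<bullet> (A *v w)) - t * (w \<bullet> (A *v v)) + t * t * b"
      by (simp add: matrix_vector_mult_diff_distrib mult_vec_scaleR inner_diff_left
          inner_diff_right b_def algebra_simps)
    also have "\<dots> = - 2 * t * (w \<bullet> w) + t\<^sup>2 * b"
      using zero vw by (simp add: w_def power2_eq_square)
    finally show ?thesis by simp
  qed
  have "w \<bullet> w \<le> 0"
  proof (cases "b = 0")
    case True
    with ineq[of 1] show ?thesis by simp
  next
    case False
    with b have "b > 0" by simp
    \<comment> \<open>This \<open>t\<close> minimizes the polynomial
      \<open>t\<^sup>2 * b - 2 * t * (w \<bullet> w)\<close>.\<close>
    with ineq[of "(w \<bullet> w) / b"] have "2 * (w \<bullet> w)\<^sup>2 / b \<le> (w \<bullet> w)\<^sup>2 / b"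
      by (simp add: power2_eq_square)
    with \<open>b > 0\<close> have "(w \<bullet> w)\<^sup>2 \<le> 0"
      by (simp add: divide_le_cancel)
    then show ?thesis by simp
  qed
  then show ?thesis
    using inner_gt_zero_iff[of w] by (auto simp: w_def not_less[symmetric])
qed

lemma norm_le_sum_entries:
  "norm (A :: complex^'n^'m) \<le> (\<Sum>i\<in>UNIV. \<Sum>j\<in>UNIV. cmod (A $ i $ j))"
  unfolding norm_vec_def
  by (rule order_trans[OF L2_set_le_sum sum_mono]) (auto simp: L2_set_le_sum)

lemma matrix_eq_zeroI: "(\<And>v. A *v v = 0) \<Longrightarrow> A = (0 :: complex^'n^'m)"
  by (metis matrix_eq matrix_vector_mult_0)

text \<open>Such test vectors expose one off-diagonal entry, rotated by a free phase
  \<open>c\<close>. The case \<open>i = j\<close> is included; with \<open>c = 1\<close> it isolates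
  a diagonal entry.\<close>

lemma form_axis_pair:
  fixes A :: "complex^'n^'n"
  assumes A: "dagger A = A" and v: "v = axis i 1 + axis j c" and c: "cmod c = 1"
  shows "v \<bullet> (A *v v) = Re (A $ i $ i) + Re (A $ j $ j) + 2 * Re (c * A $ i $ j)"
proof -
  have ax: "axis k a \<bullet> (A *v axis l b) = Re (cnj a * A $ k $ l * b)" for k l a b
  proof -
    have "A *v axis l b = (\<chi> i. A $ i $ l * b)"
      by (simp add: vec_eq_iff matrix_vector_mult_def axis_def if_distrib[of "(*) _"] cong: if_cong)
    then show ?thesis
      by (simp add: inner_axis' inner_complex_def algebra_simps)
  qed
  have "cnj c * c = 1"
    using c by (metis complex_norm_square mult.commute of_real_1 power_one)
  then have cc: "cnj c * A $ j $ j * c = A $ j $ j"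
    by (metis mult.assoc mult.commute mult_1)
  have "A $ j $ i = cnj (A $ i $ j)"
    using A by (metis dagger_nth)
  then show ?thesis
    unfolding v by (simp add: matrix_vector_right_distrib inner_add_left inner_add_right ax cc)
qed

lemma psd_diag:
  assumes "psd (A :: complex^'n^'n)"
  shows "0 \<le> Re (A $ i $ i)" "A $ i $ i = of_real (Re (A $ i $ i))"
proof -
  have A: "dagger A = A" and pos: "\<And>u. 0 \<le> u \<bullet> (A *v u)"
    using assms by (auto simp: psd_def)
  show "0 \<le> Re (A $ i $ i)"
    using pos[of "axis i 1 + axis i 1"] form_axis_pair[OF A refl, of 1 i i] by simp
  have "cnj (A $ i $ i) = A $ i $ i" using A by (metis dagger_nth)
  then show "A $ i $ i = of_real (Re (A $ i $ i))"
    by (metis Reals_cnj_iff of_real_Re)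
qed

lemma psd_trace:
  assumes "psd (A :: complex^'n^'n)"
  shows "0 \<le> Re (trace A)" "trace A = of_real (Re (trace A))"
proof -
  show "0 \<le> Re (trace A)"
    unfolding trace_def by (simp add: sum_nonneg psd_diag(1)[OF assms])
  have "trace A = (\<Sum>i\<in>UNIV. of_real (Re (A $ i $ i)))"
    unfolding trace_def by (rule sum.cong[OF refl psd_diag(2)[OF assms]])
  also have "\<dots> = of_real (Re (trace A))"
    by (simp add: trace_def)
  finally show "trace A = of_real (Re (trace A))" .
qed

text \<open>With a phase that turns \<open>c * A $ i $ j\<close> into minus its modulus, positivity
  at the test vector bounds twice that modulus by two diagonal entries, each at most the trace.
  Control of traces thereby becomes control of all entries.\<close>

lemma psd_entry_le_trace:
  assumes "psd (A :: complex^'n^'n)"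
  shows "cmod (A $ i $ j) \<le> Re (trace A)"
proof -
  have A: "dagger A = A" and pos: "\<And>u. 0 \<le> u \<bullet> (A *v u)"
    using assms by (auto simp: psd_def)
  have diag: "Re (A $ k $ k) \<le> Re (trace A)" for k
    using member_le_sum[of k UNIV "\<lambda>k. Re (A $ k $ k)"] psd_diag(1)[OF assms] by (simp add: trace_def)
  define a where "a = A $ i $ j"
  define c where "c = (if a = 0 then 1 else - cnj a / cmod a)"
  have c: "cmod c = 1" by (simp add: c_def norm_divide)
  have "c * a = - of_real (cmod a)"
  proof (cases "a = 0")
    case False
    have "cnj a * a = of_real (cmod a) * of_real (cmod a)"
      by (metis complex_norm_square mult.commute of_real_power power2_eq_square)
    with False show ?thesis
      by (simp add: c_def)
  qed simp
  then have "Re (c * A $ i $ j) = - cmod (A $ i $ j)"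
    by (simp add: a_def)
  with pos[of "axis i 1 + axis j c"] form_axis_pair[OF A refl c, of i j] diag[of i] diag[of j]
  show ?thesis by simp
qed

lemma psd_add: "psd A \<Longrightarrow> psd B \<Longrightarrow> psd (A + B)"
  by (simp add: psd_def dagger_add matrix_vector_mult_add_rdistrib inner_add_right)

lemma psd_scaleR: "psd A \<Longrightarrow> 0 \<le> r \<Longrightarrow> psd (r *\<^sub>R A)"
  by (simp add: psd_def dagger_scaleR scaleR_mult_vec)

lemma psd_0 [simp]: "psd 0"
  by (simp add: psd_def vec_eq_iff)

lemma psd_sum: "(\<And>i. i \<in> I \<Longrightarrow> psd (f i)) \<Longrightarrow> psd (\<Sum>i\<in>I. f i)"
  by (induction I rule: infinite_finite_induct) (auto simp: psd_add)

lemma psd_congruence: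
  assumes "psd A" shows "psd (B ** A ** dagger B)"
proof -
  have "dagger (B ** A ** dagger B) = B ** A ** dagger B"
    using assms by (simp add: psd_def dagger_mult matrix_mul_assoc)
  then show ?thesis
    using assms by (simp add: psd_def inner_congruence)
qed

section \<open>Positive definite matrices\<close>

definition posdef :: "complex^'n^'n \<Rightarrow> bool"
  where "posdef A \<longleftrightarrow> dagger A = A \<and> (\<forall>v. v \<noteq> 0 \<longrightarrow> 0 < v \<bullet> (A *v v))"

lemma posdef_imp_psd: "posdef A \<Longrightarrow> psd A"
  unfolding posdef_def psd_def by (metis inner_zero_left less_eq_real_def)

lemma posdef_imp_invertible:
  assumes "posdef A" shows "invertible A"
proof -
  have "x = 0" if "A *v x = 0" for x
    using assms that unfolding posdef_def by (metis inner_zero_right less_irrefl)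
  then show ?thesis
    unfolding invertible_left_inverse matrix_left_invertible_ker by blast
qed

lemma rank_invertible:
  assumes "invertible (A :: complex^'n^'n)"
  shows "rank A = CARD('n)"
proof -
  have "vec.span (rows A) = UNIV"
    using assms unfolding invertible_left_inverse
    by (simp add: matrix_left_invertible_span_rows_gen)
  then show ?thesis
    unfolding row_rank_def_gen by (metis vec.dim_span vec_dim_card)
qed

lemma matrix_inv_invertible:
  assumes "invertible (A :: complex^'n^'m)"
  shows "A ** matrix_inv A = mat 1" "matrix_inv A ** A = mat 1"
proof -
  have "\<exists>B. A ** B = mat 1 \<and> B ** A = mat 1"
    using assms by (simp add: invertible_def)
  then have "A ** matrix_inv A = mat 1 \<and> matrix_inv A ** A = mat 1"
    unfolding matrix_inv_def by (rule someI_ex)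
  then show "A ** matrix_inv A = mat 1" "matrix_inv A ** A = mat 1" by auto
qed

lemma continuous_on_form [continuous_intros]:
  fixes F :: "'a::topological_space \<Rightarrow> complex^'n^'n"
  assumes "continuous_on S F" "continuous_on S g"
  shows "continuous_on S (\<lambda>x. g x \<bullet> (F x *v g x))"
  unfolding matrix_vector_mult_def
  by (intro continuous_intros assms)

section \<open>Minimum of the form, square roots and the smallest eigenvalue\<close>

text \<open>Compactness of the unit sphere provides a minimizer, and homogeneity of degree two
  extends the inequality to all \<open>v\<close>. The minimum serves both as a coercivity constant
  and, for Hermitian \<open>A\<close>, as an eigenvalue.\<close>

lemma min_form_attained:
  fixes A :: "complex^'n^'n"
  obtains u where "norm u = 1" "\<And>v. (u \<bullet> (A *v u)) * (v \<bullet> v) \<le> v \<bullet> (A *v v)"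
proof -
  have "compact (sphere (0::complex^'n) 1)" "sphere (0::complex^'n) 1 \<noteq> {}" by auto
  moreover have "continuous_on (sphere 0 1) (\<lambda>v. v \<bullet> (A *v v))"
    by (intro continuous_intros)
  ultimately obtain u where u: "u \<in> sphere 0 1" "\<And>v. v \<in> sphere 0 1 \<Longrightarrow> u \<bullet> (A *v u) \<le> v \<bullet> (A *v v)"
    using continuous_attains_inf[of "sphere 0 1" "\<lambda>v. v \<bullet> (A *v v)"] by metis
  have "(u \<bullet> (A *v u)) * (v \<bullet> v) \<le> v \<bullet> (A *v v)" for v
  proof (cases "v = 0")
    case False
    define w where "w = v /\<^sub>R norm v"
    have v: "v = norm v *\<^sub>R w" and "w \<in> sphere 0 1"
      using False by (auto simp: w_def)
    then have "u \<bullet> (A *v u) \<le> w \<bullet> (A *v w)" using u by blast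
    then have "(norm v)\<^sup>2 * (u \<bullet> (A *v u)) \<le> (norm v)\<^sup>2 * (w \<bullet> (A *v w))"
      by (intro mult_left_mono) auto
    also have "\<dots> = v \<bullet> (A *v v)"
      using arg_cong[OF v, of "\<lambda>x. x \<bullet> (A *v x)"] by (simp add: mult_vec_scaleR power2_eq_square)
    finally show ?thesis by (simp add: power2_norm_eq_inner mult.commute)
  qed simp
  moreover have "norm u = 1" using u(1) by simp
  ultimately show thesis using that by blast
qed

lemma posdef_lower_bound:
  assumes "posdef A"
  obtains e where "e > 0" "\<And>v. e * (v \<bullet> v) \<le> v \<bullet> (A *v v)"
proof -
  obtain u where u: "norm u = 1" "\<And>v. (u \<bullet> (A *v u)) * (v \<bullet> v) \<le> v \<bullet> (A *v v)"
    using min_form_attained[of A] by blast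
  then have "u \<bullet> (A *v u) > 0"
    using assms unfolding posdef_def by (metis norm_zero zero_neq_one)
  with u that show thesis by blast
qed

text \<open>
  After scaling, \<open>A = t (1 - X)\<close> with \<open>X\<close> a Hermitian contraction; the root is \<open>\<surd>t (1 - Y)\<close> for a fixed
  point of \<open>Y \<mapsto> (X + Y\<^sup>2) / 2\<close>, which Brouwer's theorem provides.
\<close>

lemma posdef_sqrt_exists:
  fixes A :: "complex^'n^'n"
  assumes "posdef A"
  obtains B where "psd B" "B ** B = A"
proof -
  have A: "dagger A = A" using assms by (simp add: posdef_def)
  obtain e where e: "e > 0" "\<And>v. e * (v \<bullet> v) \<le> v \<bullet> (A *v v)"
    using posdef_lower_bound[OF assms] by blast
  obtain K where K: "K > 0" "\<And>v. norm (A *v v) \<le> norm v * K"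
    using bounded_linear.pos_bounded[OF matrix_vector_mul_bounded_linear] by blast
  \<comment> \<open>In the expansion of \<open>(norm (X *v v))\<^sup>2\<close> the cross term is at
    most \<open>- 2 * e / t\<close> and the last term at most
    \<open>K\<^sup>2 / t\<^sup>2 = e / t\<close>, each times \<open>v \<bullet> v\<close>. This
    choice of \<open>t\<close> therefore makes \<open>X\<close> a contraction.\<close>
  define t where "t = K\<^sup>2 / e"
  have t: "t > 0" using e K by (simp add: t_def)
  have "K\<^sup>2 = e * t" using e by (simp add: t_def)
  define X where "X = mat 1 - (1/t) *\<^sub>R A"
  have X: "dagger X = X" by (simp add: X_def dagger_diff dagger_scaleR A)
  have Xv: "norm (X *v v) \<le> norm v" for v
  proof -
    have expand: "(norm (x - r *\<^sub>R y))\<^sup>2 = x \<bullet> x - 2 * r * (x \<bullet> y) + r\<^sup>2 * (norm y)\<^sup>2"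
      for x y :: "complex^'n" and r
      unfolding power2_norm_eq_inner
      by (simp add: inner_diff_left inner_diff_right inner_commute[of y x] power2_eq_square algebra_simps)
    have "X *v v = v - (1/t) *\<^sub>R (A *v v)"
      by (simp add: X_def matrix_vector_mult_diff_rdistrib scaleR_mult_vec)
    then have "(norm (X *v v))\<^sup>2 = v \<bullet> v - 2 / t * (v \<bullet> (A *v v)) + (norm (A *v v))\<^sup>2 / t\<^sup>2"
      by (simp add: expand power_divide)
    also have "\<dots> \<le> v \<bullet> v - 2 / t * (e * (v \<bullet> v)) + (norm v * K)\<^sup>2 / t\<^sup>2"
      by (intro add_mono diff_mono mult_left_mono divide_right_mono power_mono e(2) K(2))
        (use t in auto)
    also have "\<dots> = v \<bullet> v - e / t * (v \<bullet> v)"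
    proof -
      have "(norm v * K)\<^sup>2 / t\<^sup>2 = e / t * (v \<bullet> v)"
        unfolding dot_square_norm power_mult_distrib using \<open>K\<^sup>2 = e * t\<close> t
        by (simp add: power2_eq_square)
      then show ?thesis by simp
    qed
    also have "\<dots> \<le> (norm v)\<^sup>2"
      using e t by (simp add: power2_norm_eq_inner)
    finally show ?thesis by (rule power2_le_imp_le) simp
  qed
  \<comment> \<open>The Hermitian contractions form a compact convex set, and the map preserves it
    because \<open>X\<close> and the square of a contraction are contractions.\<close>
  define W where "W = {Y :: complex^'n^'n. dagger Y = Y \<and> (\<forall>v. norm (Y *v v) \<le> norm v)}"
  have "\<exists>Y\<in>W. (1/2) *\<^sub>R (X + Y ** Y) = Y"
  proof -
    have "closed W"
    proof -
      have "W = {Y. dagger Y = Y} \<inter> (\<Inter>v. {Y. norm (Y *v v) \<le> norm v})"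
        by (auto simp: W_def)
      moreover have "closed {Y :: complex^'n^'n. dagger Y = Y}"
        unfolding dagger_def by (intro closed_Collect_eq continuous_intros)
      moreover have "closed {Y :: complex^'n^'n. norm (Y *v v) \<le> norm v}" for v
        unfolding matrix_vector_mult_def by (intro closed_Collect_le continuous_intros)
      ultimately show ?thesis by (simp add: closed_INT closed_Int)
    qed
    moreover have "bounded W"
    proof -
      have "norm Y \<le> (\<Sum>i::'n\<in>UNIV. \<Sum>j::'n\<in>UNIV. 1)" if "Y \<in> W" for Y
      proof -
        have "cmod (Y $ i $ j) \<le> 1" for i j
        proof -
          have "Y $ i $ j = (Y *v axis j 1) $ i"
            by (simp add: matrix_vector_mult_def axis_def if_distrib[of "(*) _"] cong: if_cong)
          then have "cmod (Y $ i $ j) \<le> norm (Y *v axis j 1)"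
            by (simp add: Finite_Cartesian_Product.norm_nth_le)
          also have "\<dots> \<le> norm (axis j (1::complex) :: complex^'n)" using that unfolding W_def by blast
          also have "\<dots> = 1" by (simp add: norm_eq_sqrt_inner inner_axis_axis)
          finally show ?thesis .
        qed
        then show ?thesis using norm_le_sum_entries[of Y] by (meson order_trans sum_mono)
      qed
      then show ?thesis by (meson boundedI)
    qed
    ultimately have "compact W" by (simp add: compact_eq_bounded_closed)
    moreover have "convex W"
    proof (rule convexI)
      fix P Q :: "complex^'n^'n" and u v :: real
      assume P: "P \<in> W" and Q: "Q \<in> W" and uv: "0 \<le> u" "0 \<le> v" "u + v = 1"
      have "norm ((u *\<^sub>R P + v *\<^sub>R Q) *v x) \<le> norm x" for x
      proof -
        have "norm ((u *\<^sub>R P + v *\<^sub>R Q) *v x) \<le> u * norm (P *v x) + v * norm (Q *v x)"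
          using uv by (simp add: matrix_vector_mult_add_rdistrib scaleR_mult_vec norm_triangle_le)
        also have "\<dots> \<le> u * norm x + v * norm x"
          using P Q uv by (intro add_mono mult_left_mono) (auto simp: W_def)
        also have "\<dots> = norm x" using uv by (metis distrib_right mult_1)
        finally show ?thesis .
      qed
      then show "u *\<^sub>R P + v *\<^sub>R Q \<in> W"
        using P Q by (simp add: W_def dagger_add dagger_scaleR)
    qed
    moreover have "W \<noteq> {}"
      using X Xv by (auto simp: W_def)
    moreover have "continuous_on W (\<lambda>Y. (1/2) *\<^sub>R (X + Y ** Y))"
      unfolding matrix_matrix_mult_def by (intro continuous_intros)
    moreover have "(1/2) *\<^sub>R (X + Y ** Y) \<in> W" if "Y \<in> W" for Y
    proof -
      have "norm (((1/2) *\<^sub>R (X + Y ** Y)) *v v) \<le> norm v" for v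
      proof -
        have "norm (Y *v (Y *v v)) \<le> norm v"
          using that unfolding W_def by (simp, meson order_trans)
        then have "norm (X *v v + Y *v (Y *v v)) \<le> 2 * norm v"
          using Xv[of v] norm_triangle_ineq[of "X *v v" "Y *v (Y *v v)"] by linarith
        then show ?thesis
          by (simp add: scaleR_mult_vec matrix_vector_mult_add_rdistrib matrix_vector_mul_assoc
              del: scaleR_add_right)
      qed
      then show ?thesis using that X by (simp add: W_def dagger_add dagger_scaleR dagger_mult)
    qed
    ultimately show ?thesis
      using brouwer[of W "\<lambda>Y. (1/2) *\<^sub>R (X + Y ** Y)"] by blast
  qed
  then obtain Y where Y: "Y \<in> W" "(1/2) *\<^sub>R (X + Y ** Y) = Y" by blast
  define C where "C = mat 1 - Y"
  \<comment> \<open>Completing the square in the fixed-point equation turns it into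
    \<open>C ** C = mat 1 - X\<close>.\<close>
  have "2 *\<^sub>R Y = X + Y ** Y" by (subst Y(2)[symmetric]) simp
  then have "C ** C = mat 1 - X"
    by (simp add: C_def matrix_diff_left matrix_diff_right scaleR_2 algebra_simps)
  then have CC: "C ** C = (1/t) *\<^sub>R A" by (simp add: X_def)
  have "psd C"
  proof -
    have "0 \<le> v \<bullet> (C *v v)" for v
    proof -
      have "v \<bullet> (Y *v v) \<le> norm v * norm (Y *v v)" by (rule norm_cauchy_schwarz)
      also have "\<dots> \<le> norm v * norm v"
        using Y(1) by (intro mult_left_mono) (auto simp: W_def)
      also have "\<dots> = v \<bullet> v" by (metis power2_eq_square power2_norm_eq_inner)
      finally show ?thesis by (simp add: C_def matrix_vector_mult_diff_rdistrib inner_diff_right)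
    qed
    then show ?thesis
      using Y(1) by (simp add: psd_def C_def W_def dagger_diff)
  qed
  then have "psd (sqrt t *\<^sub>R C)" using t by (simp add: psd_scaleR)
  moreover have "(sqrt t *\<^sub>R C) ** (sqrt t *\<^sub>R C) = A"
  proof -
    have "(sqrt t *\<^sub>R C) ** (sqrt t *\<^sub>R C) = (sqrt t * sqrt t) *\<^sub>R (C ** C)"
      by (simp only: matrix_scalar_ac scalar_matrix_assoc[symmetric] scaleR_scaleR)
    also have "\<dots> = A" using t CC by simp
    finally show ?thesis .
  qed
  ultimately show thesis by (rule that)
qed

lemma mat_sqrt_posdef:
  assumes "posdef A"
  shows "psd (mat_sqrt A)" "mat_sqrt A ** mat_sqrt A = A"
proof -
  have "\<exists>B. psd B \<and> B ** B = A" using posdef_sqrt_exists[OF assms] by metis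
  then have "psd (mat_sqrt A) \<and> mat_sqrt A ** mat_sqrt A = A"
    unfolding mat_sqrt_def by (rule someI_ex)
  then show "psd (mat_sqrt A)" "mat_sqrt A ** mat_sqrt A = A" by auto
qed

lemma mat_sqrt_invertible:
  assumes "posdef A" shows "invertible (mat_sqrt A)"
proof -
  obtain C where "C ** A = mat 1"
    using posdef_imp_invertible[OF assms] by (auto simp: invertible_left_inverse)
  then have "(C ** mat_sqrt A) ** mat_sqrt A = mat 1"
    by (metis mat_sqrt_posdef(2)[OF assms] matrix_mul_assoc)
  then show ?thesis unfolding invertible_left_inverse by blast
qed

text \<open>\<open>Min\<close> is meaningful only on a finite nonempty set. Eigenvectors of distinct
  real eigenvalues are orthogonal, which gives finiteness; the minimum of the form on the unit
  sphere is an eigenvalue. Evaluating the form at an eigenvector gives positivity.\<close>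

lemma min_eigenvalue_posdef:
  fixes A :: "complex^'n^'n"
  assumes "posdef A" shows "min_eigenvalue A > 0"
proof -
  have A: "dagger A = A" using assms by (simp add: posdef_def)
  let ?E = "{r. eigenvalue A (complex_of_real r)}"
  have scale: "complex_of_real r *s v = r *\<^sub>R v" for r and v :: "complex^'n"
    by (simp add: vec_eq_iff scaleR_conv_of_real[where 'a = complex])
  have pos: "r > 0" if "r \<in> ?E" for r
  proof -
    from that obtain v where v: "v \<noteq> 0" "A *v v = r *\<^sub>R v"
      by (auto simp: eigenvalue_def scale)
    then have "0 < v \<bullet> (A *v v)" using assms unfolding posdef_def by blast
    then have "0 < r * (v \<bullet> v)" by (simp add: v)
    then show ?thesis by (metis inner_ge_zero not_less zero_less_mult_pos2 mult_nonpos_nonneg)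
  qed
  have "finite ?E"
  proof -
    have "\<forall>r\<in>?E. \<exists>v. v \<noteq> 0 \<and> A *v v = r *\<^sub>R v"
      by (auto simp: eigenvalue_def scale)
    then obtain f where f: "\<And>r. r \<in> ?E \<Longrightarrow> f r \<noteq> 0 \<and> A *v f r = r *\<^sub>R f r"
      by metis
    have orth: "orthogonal (f r) (f s)" if "r \<in> ?E" "s \<in> ?E" "r \<noteq> s" for r s
    proof -
      have "f r \<bullet> (A *v f s) = (A *v f r) \<bullet> f s" by (rule inner_hermitian[OF A])
      then have "s * (f r \<bullet> f s) = r * (f r \<bullet> f s)" using f that by simp
      then show ?thesis using that by (simp add: orthogonal_def)
    qed
    have "inj_on f ?E"
      using orth f by (metis (no_types, lifting) inj_onI orthogonal_self)
    moreover have "finite (f ` ?E)"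
    proof -
      have "pairwise orthogonal (f ` ?E)"
        using orth by (auto simp: pairwise_def) 
      moreover have "0 \<notin> f ` ?E" using f by force
      ultimately show ?thesis
        using pairwise_orthogonal_independent independent_bound by blast
    qed
    ultimately show ?thesis by (simp add: finite_image_iff)
  qed
  moreover have "?E \<noteq> {}"
  proof -
    obtain u where u: "norm u = 1" "\<And>v. (u \<bullet> (A *v u)) * (v \<bullet> v) \<le> v \<bullet> (A *v v)"
      using min_form_attained[of A] by blast
    define r where "r = u \<bullet> (A *v u)"
    \<comment> \<open>Shifting by the minimum leaves a positive semidefinite matrix whose form
      vanishes at \<open>u\<close>, so \<open>psd_kernel\<close> turns the minimizer into an
      eigenvector.\<close>
    define B where "B = A - r *\<^sub>R mat 1"
    have form: "v \<bullet> (B *v v) = v \<bullet> (A *v v) - r * (v \<bullet> v)" for v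
      by (simp add: B_def matrix_vector_mult_diff_rdistrib scaleR_mult_vec inner_diff_right)
    have "psd B"
      using u(2) A by (simp add: psd_def form r_def) (simp add: B_def dagger_diff dagger_scaleR)
    moreover have "u \<bullet> (B *v u) = 0"
      using u(1) by (simp add: form r_def norm_eq_1)
    ultimately have "B *v u = 0" by (rule psd_kernel)
    then have "A *v u = of_real r *s u"
      by (simp add: B_def matrix_vector_mult_diff_rdistrib scaleR_mult_vec scale)
    moreover have "u \<noteq> 0" using u(1) by auto
    ultimately have "r \<in> ?E" unfolding eigenvalue_def by blast
    then show ?thesis by blast
  qed
  ultimately show ?thesis
    unfolding min_eigenvalue_def using pos Min_in by blast
qed

section \<open>Positive fixed points of transfer operators\<close>

lemma linear_sandwich: "linear (\<lambda>X :: complex^'n^'m. A ** X ** B)"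
proof (rule linearI)
  show "A ** (X + Y) ** B = A ** X ** B + A ** Y ** B" for X Y :: "complex^'n^'m"
    by (simp add: matrix_matrix_mult_def vec_eq_iff algebra_simps sum.distrib)
  show "A ** (r *\<^sub>R X) ** B = r *\<^sub>R (A ** X ** B)" for r and X :: "complex^'n^'m"
    by (simp only: matrix_scalar_ac scalar_matrix_assoc[symmetric])
qed

lemma linear_transfer: "linear (transfer T)"
  unfolding transfer_def by (intro linear_compose_sum ballI linear_sandwich)

lemma transfer_mat_scale: "transfer T (mat_scale a f) = mat_scale a (transfer T f)"
  by (simp add: transfer_def mat_scale_mult_left mat_scale_mult_right cmat.scale_sum_right)

lemma transfer_dagger: "transfer T (dagger f) = dagger (transfer T f)"
  by (simp add: transfer_def dagger_sum dagger_mult matrix_mul_assoc)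

lemma psd_transfer: "psd f \<Longrightarrow> psd (transfer T f)"
  unfolding transfer_def by (intro psd_sum psd_congruence)

text \<open>Cyclicity of the trace; the transfer operator of \<open>dagger \<circ> T\<close> is the
  dual map. Trace preservation thus reduces to the dual map fixing the identity.\<close>

lemma trace_transfer: "trace (transfer T f) = trace (transfer (dagger \<circ> T) (mat 1) ** f)"
proof -
  have "trace (T j ** f ** dagger (T j)) = trace (dagger (T j) ** T j ** f)" for j
    using trace_mul_sym[of "T j ** f" "dagger (T j)"] by (simp add: matrix_mul_assoc)
  moreover have "(\<Sum>j\<in>UNIV. dagger (T j) ** T j) ** f = (\<Sum>j\<in>UNIV. dagger (T j) ** T j ** f)"
    using linear_sum[OF linear_sandwich[of "mat 1" f]] by simp
  ultimately show ?thesis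
    by (simp add: transfer_def trace_sum)
qed

text \<open>If the form of the image vanished at some \<open>v \<noteq> 0\<close>, then
  \<open>f\<close> would annihilate every \<open>dagger (T j) *v v\<close>, hence by spanning every
  \<open>dagger X *v v\<close>. These are all vectors, which contradicts
  \<open>trace f = 1\<close>.\<close>

lemma transfer_posdef:
  fixes T :: "'d::finite \<Rightarrow> complex^'n^'n"
  assumes span: "cmat.span (range T) = UNIV" and f: "density_matrix f"
  shows "posdef (transfer T f)"
proof -
  have "psd f" "trace f = 1" using f by (auto simp: density_matrix_def)
  have P: "psd (transfer T f)" by (rule psd_transfer[OF \<open>psd f\<close>])
  have "v \<bullet> (transfer T f *v v) \<noteq> 0" if "v \<noteq> 0" for v
  proof
    assume zero: "v \<bullet> (transfer T f *v v) = 0"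
    have sum_vec: "(\<Sum>j\<in>UNIV. A j) *v v = (\<Sum>j\<in>UNIV. A j *v v)" for A :: "'d \<Rightarrow> complex^'n^'n"
    proof -
      have "linear (\<lambda>X :: complex^'n^'n. X *v v)"
        by (rule linearI) (simp_all add: matrix_vector_mult_add_rdistrib scaleR_mult_vec)
      then show ?thesis by (rule linear_sum)
    qed
    have "(\<Sum>j\<in>UNIV. v \<bullet> ((T j ** f ** dagger (T j)) *v v)) = 0"
      using zero by (simp add: transfer_def sum_vec inner_sum_right)
    moreover have "0 \<le> v \<bullet> ((T j ** f ** dagger (T j)) *v v)" for j
      using psd_congruence[OF \<open>psd f\<close>] unfolding psd_def by blast
    ultimately have "v \<bullet> ((T j ** f ** dagger (T j)) *v v) = 0" for j
      by (simp add: sum_nonneg_eq_0_iff)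
    then have T0: "f *v (dagger (T j) *v v) = 0" for j
      unfolding inner_congruence by (intro psd_kernel[OF \<open>psd f\<close>])
    \<comment> \<open>Although \<open>dagger\<close> is conjugate linear, the \<open>X\<close> with
      this property form a complex subspace.\<close>
    have all: "f *v (dagger X *v v) = 0" for X
    proof -
      have "X \<in> cmat.span (range T)" using span by simp
      then show ?thesis
      proof (induction rule: cmat.span_induct)
        case base
        have "dagger (0::complex^'n^'n) = 0" by (simp add: vec_eq_iff)
        then show ?case
          by (auto intro!: cmat.subspaceI simp: dagger_add dagger_mat_scale matrix_vector_mult_add_rdistrib
              matrix_vector_right_distrib mat_scale_mult_vec vector_scalar_commute vec.scale_zero_right)
      qed (use T0 in auto)
    qed
    have "f *v w = 0" for w
    proof -
      define s where "s = (\<Sum>k\<in>UNIV. cnj (v $ k) * v $ k)"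
      have "s = of_real (\<Sum>k\<in>UNIV. (cmod (v $ k))\<^sup>2)"
        unfolding of_real_sum complex_norm_square s_def by (simp only: mult.commute)
      moreover have "(\<Sum>k\<in>UNIV. (cmod (v $ k))\<^sup>2) \<noteq> 0"
        using \<open>v \<noteq> 0\<close> by (simp add: sum_nonneg_eq_0_iff vec_eq_iff)
      ultimately have "s \<noteq> 0" by (metis of_real_eq_0_iff)
      \<comment> \<open>A rank-one matrix sending \<open>v\<close> to \<open>w\<close>;
        \<open>s\<close> is the squared norm of \<open>v\<close>.\<close>
      define X :: "complex^'n^'n" where "X = (\<chi> i k. w $ i * cnj (v $ k) / s)"
      have "X *v v = w"
        using \<open>s \<noteq> 0\<close>
        by (simp add: X_def vec_eq_iff matrix_vector_mult_def mult.assoc sum_distrib_left[symmetric]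
            sum_divide_distrib[symmetric] s_def)
      then show ?thesis using all[of "dagger X"] by simp
    qed
    then have "f = 0" by (rule matrix_eq_zeroI)
    then have "trace f = 0" by (simp add: trace_def)
    with \<open>trace f = 1\<close> show False by simp
  qed
  then show ?thesis
    using P unfolding posdef_def psd_def by (metis order_le_imp_less_or_eq)
qed

lemma psd_density_scale:
  assumes "psd (A :: complex^'n^'n)" "trace A \<noteq> 0"
  shows "0 < Re (trace A)" "density_matrix ((1 / Re (trace A)) *\<^sub>R A)"
proof -
  have tr: "trace A = of_real (Re (trace A))" "0 \<le> Re (trace A)"
    using psd_trace[OF assms(1)] by auto
  with assms(2) show pos: "0 < Re (trace A)"
    by (metis less_eq_real_def of_real_0)
  have "trace ((1 / Re (trace A)) *\<^sub>R A) = (1 / Re (trace A)) *\<^sub>R of_real (Re (trace A))"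
    by (metis tr(1) trace_scaleR)
  also have "\<dots> = 1" using pos by (simp add: scaleR_conv_of_real)
  finally show "density_matrix ((1 / Re (trace A)) *\<^sub>R A)"
    using assms(1) pos by (simp add: density_matrix_def psd_scaleR)
qed

lemma posdef_trace_nz:
  assumes "posdef (A :: complex^'n^'n)" shows "trace A \<noteq> 0"
proof
  assume "trace A = 0"
  moreover have P: "psd A" by (rule posdef_imp_psd[OF assms])
  ultimately have "A $ i $ j = 0" for i j
    using psd_entry_le_trace[OF P, of i j] by simp
  then have "A = 0" by (simp add: vec_eq_iff)
  then have "\<not> posdef A"
    by (metis axis_eq_0_iff inner_zero_right less_irrefl matrix_vector_mult_0 posdef_def zero_neq_one)
  with assms show False by simp
qed

lemma compact_density: "compact {f :: complex^'n^'n. density_matrix f}"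
proof -
  have "{f :: complex^'n^'n. density_matrix f}
      = {f. dagger f = f} \<inter> {f. trace f = 1} \<inter> (\<Inter>v. {f. 0 \<le> v \<bullet> (f *v v)})"
    by (auto simp: density_matrix_def psd_def)
  moreover have "closed {f :: complex^'n^'n. dagger f = f}"
    unfolding dagger_def by (intro closed_Collect_eq continuous_intros)
  moreover have "closed {f :: complex^'n^'n. trace f = 1}"
    unfolding trace_def by (intro closed_Collect_eq continuous_intros)
  moreover have "closed {f :: complex^'n^'n. 0 \<le> v \<bullet> (f *v v)}" for v
    by (intro closed_Collect_le continuous_intros)
  ultimately have "closed {f :: complex^'n^'n. density_matrix f}"
    by (simp add: closed_INT closed_Int)
  moreover have "norm f \<le> (\<Sum>i::'n\<in>UNIV. \<Sum>j::'n\<in>UNIV. 1)" if "density_matrix f" for f :: "complex^'n^'n"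
  proof -
    have "cmod (f $ i $ j) \<le> 1" for i j
      using that psd_entry_le_trace[of f i j] by (simp add: density_matrix_def)
    then show ?thesis using norm_le_sum_entries[of f] by (meson order_trans sum_mono)
  qed
  then have "bounded {f :: complex^'n^'n. density_matrix f}"
    by (intro boundedI) auto
  ultimately show ?thesis by (simp add: compact_eq_bounded_closed)
qed

lemma convex_density: "convex {f :: complex^'n^'n. density_matrix f}"
proof (rule convexI, clarify)
  fix P Q :: "complex^'n^'n" and u v :: real
  assume "density_matrix P" "density_matrix Q" "0 \<le> u" "0 \<le> v" "u + v = 1"
  moreover from \<open>u + v = 1\<close> have "complex_of_real u + of_real v = 1"
    by (metis of_real_1 of_real_add)
  ultimately show "density_matrix (u *\<^sub>R P + v *\<^sub>R Q)"
    by (simp add: density_matrix_def psd_add psd_scaleR trace_add trace_scaleR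
        scaleR_conv_of_real[where 'a = complex])
qed

lemma density_nonempty: "\<exists>f :: complex^'n^'n. density_matrix f"
proof -
  have "posdef (mat 1 :: complex^'n^'n)" by (simp add: posdef_def)
  then show ?thesis using psd_density_scale(2) posdef_imp_psd posdef_trace_nz by blast
qed

text \<open>Brouwer's theorem is applied to the transfer operator divided by the trace of its value,
  which is positive on density matrices. The fixed point is positive definite because it is a
  positive multiple of an image.\<close>

lemma perron_eigenmatrix:
  fixes T :: "'d::finite \<Rightarrow> complex^'n^'n"
  assumes span: "cmat.span (range T) = UNIV"
  obtains g r where "density_matrix g" "posdef g" "r > 0" "transfer T g = r *\<^sub>R g"
proof -
  let ?D = "{f :: complex^'n^'n. density_matrix f}"
  let ?t = "\<lambda>f. Re (trace (transfer T f))"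
  have D: "?t f > 0 \<and> density_matrix ((1 / ?t f) *\<^sub>R transfer T f) \<and> posdef ((1 / ?t f) *\<^sub>R transfer T f)"
    if "density_matrix f" for f
  proof -
    have p: "posdef (transfer T f)" by (rule transfer_posdef[OF span that])
    note * = psd_density_scale[OF posdef_imp_psd[OF p] posdef_trace_nz[OF p]]
    moreover have "posdef ((1 / ?t f) *\<^sub>R transfer T f)"
      using p *(1) by (simp add: posdef_def dagger_scaleR scaleR_mult_vec)
    ultimately show ?thesis by blast
  qed
  have cont: "continuous_on ?D (transfer T)"
    using linear_transfer linear_conv_bounded_linear linear_continuous_on by blast
  have "continuous_on ?D (\<lambda>f. (1 / ?t f) *\<^sub>R transfer T f)"
    unfolding trace_def
    by (intro continuous_intros cont) (use D in \<open>force simp: trace_def\<close>)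
  moreover have "(\<lambda>f. (1 / ?t f) *\<^sub>R transfer T f) \<in> ?D \<rightarrow> ?D"
    using D by blast
  moreover have "?D \<noteq> {}" using density_nonempty by blast
  ultimately obtain g where g: "density_matrix g" "(1 / ?t g) *\<^sub>R transfer T g = g"
    using brouwer[OF compact_density convex_density, of "\<lambda>f. (1 / ?t f) *\<^sub>R transfer T f"] by blast
  have "?t g > 0" "posdef g" using D[OF g(1)] g(2) by auto
  moreover have "transfer T g = ?t g *\<^sub>R g"
    using arg_cong[OF g(2), of "\<lambda>x. ?t g *\<^sub>R x"] \<open>?t g > 0\<close> by simp
  ultimately show thesis using that g(1) by blast
qed

section \<open>Passage to a trace-preserving gauge\<close>

text \<open>The matrices that \<open>h\<close> sends into the span on the left form a complex
  subspace containing every \<open>T j\<close>. The function \<open>k\<close> admits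
  conjugate-linear maps: \<open>cnj\<close> serves for \<open>dagger\<close>, the identity for a
  change of gauge.\<close>

lemma span_range_image:
  fixes T :: "'d \<Rightarrow> complex^'n^'n"
  assumes span: "cmat.span (range T) = UNIV"
    and add: "\<And>X Y. h (X + Y) = h X + h Y" and scale: "\<And>a X. h (mat_scale a X) = mat_scale (k a) (h X)"
    and surj: "surj (h :: complex^'n^'n \<Rightarrow> complex^'n^'n)"
  shows "cmat.span (range (h \<circ> T)) = UNIV"
proof -
  have "h 0 = 0" using add[of 0 0] by simp
  have "h X \<in> cmat.span (range (h \<circ> T))" for X
  proof -
    have "X \<in> cmat.span (range T)" using span by simp
    then show ?thesis
    proof (induction rule: cmat.span_induct)
      case base
      show ?case
        by (rule cmat.subspaceI)
          (auto simp: add scale \<open>h 0 = 0\<close> cmat.span_zero intro: cmat.span_add cmat.span_scale)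
    qed (auto intro: cmat.span_base)
  qed
  then show ?thesis using surj by (metis UNIV_eq_I surjD)
qed

lemma span_range_dagger:
  fixes T :: "'d \<Rightarrow> complex^'n^'n"
  assumes "cmat.span (range T) = UNIV"
  shows "cmat.span (range (dagger \<circ> T)) = UNIV"
  by (rule span_range_image[OF assms dagger_add dagger_mat_scale]) (metis dagger_dagger surjI)

lemma mps_injective_span:
  assumes "mps_injective T" shows "cmat.span (range T) = UNIV"
proof -
  have "{mps_word T js | js. length js = 1} = range T"
    by (force simp: mps_word_def length_Suc_conv)
  moreover have "cmat.span {mps_word T js | js. length js = 1} = UNIV"
    using assms unfolding mps_injective_def by blast
  ultimately show ?thesis by simp
qed

text \<open>Conjugating by a square root of the Perron matrix of the dual map makes the channel
  trace preserving.\<close>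

lemma trace_preserving_gauge:
  fixes T :: "'d::finite \<Rightarrow> complex^'n^'n"
  assumes span: "cmat.span (range T) = UNIV"
  obtains S where "mps_representation T S" "cmat.span (range S) = UNIV"
    "\<And>f. trace (transfer S f) = trace f"
proof -
  obtain g r where g: "posdef g" "r > 0" "transfer (dagger \<circ> T) g = r *\<^sub>R g"
    using perron_eigenmatrix[OF span_range_dagger[OF span]] by metis
  define Z where "Z = mat_sqrt g"
  define Y where "Y = matrix_inv Z"
  have Z: "dagger Z = Z" "Z ** Z = g" "invertible Z"
    using mat_sqrt_posdef[OF g(1)] mat_sqrt_invertible[OF g(1)] by (auto simp: Z_def psd_def)
  have ZY: "Z ** Y = mat 1" "Y ** Z = mat 1"
    using matrix_inv_invertible[OF Z(3)] by (auto simp: Y_def)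
  \<comment> \<open>The scalar divides out the Perron eigenvalue \<open>r\<close>, which enters
    through the squared modulus of \<open>\<mu>\<close>.\<close>
  define \<mu> where "\<mu> = complex_of_real (1 / sqrt r)"
  have \<mu>: "\<mu> \<noteq> 0" "cnj \<mu> * \<mu> = of_real (1 / r)"
    using g(2) by (auto simp: \<mu>_def simp flip: of_real_mult of_real_divide)
  define h where "h = (\<lambda>X. mat_scale \<mu> (Z ** X ** Y))"
  define S where "S = h \<circ> T"
  have rep: "mps_representation T S"
    unfolding mps_representation_def S_def h_def Y_def using \<mu>(1) Z(3) by auto
  have "surj h"
  proof (rule surjI)
    fix X show "h (mat_scale (1 / \<mu>) (Y ** X ** Z)) = X"
    proof -
      have "Z ** (Y ** X ** Z) ** Y = (Z ** Y) ** X ** (Z ** Y)"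
        by (simp only: matrix_mul_assoc)
      then show ?thesis using \<mu>(1) by (simp add: h_def mat_scale_mult_left mat_scale_mult_right ZY)
    qed
  qed
  moreover have "h (X + X') = h X + h X'" for X X'
    by (simp add: h_def linear_add[OF linear_sandwich] cmat.scale_right_distrib)
  moreover have "h (mat_scale a X) = mat_scale a (h X)" for a X
    by (simp add: h_def mat_scale_mult_left mat_scale_mult_right mult.commute)
  ultimately have spanS: "cmat.span (range S) = UNIV"
    unfolding S_def using span_range_image[OF span, of h "\<lambda>a. a"] by blast
  have dY: "dagger Y ** Z = mat 1"
    using arg_cong[OF ZY(1), of dagger] by (simp add: dagger_mult Z(1))
  have "dagger (S j) ** S j = (1 / r) *\<^sub>R (dagger Y ** (dagger (T j) ** g ** T j) ** Y)" for j
  proof -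
    have "dagger (S j) ** S j = mat_scale (cnj \<mu> * \<mu>) (dagger Y ** dagger (T j) ** Z ** (Z ** T j ** Y))"
      by (simp add: S_def h_def dagger_mat_scale dagger_mult Z(1) mat_scale_mult_left mat_scale_mult_right
          matrix_mul_assoc mult.commute)
    also have "dagger Y ** dagger (T j) ** Z ** (Z ** T j ** Y) = dagger Y ** (dagger (T j) ** g ** T j) ** Y"
      by (simp only: matrix_mul_assoc Z(2)[symmetric])
    finally show ?thesis unfolding \<mu>(2) mat_scale_of_real .
  qed
  then have "transfer (dagger \<circ> S) (mat 1) = (\<Sum>j\<in>UNIV. (1 / r) *\<^sub>R (dagger Y ** (dagger (T j) ** g ** T j) ** Y))"
    by (simp add: transfer_def)
  also have "\<dots> = (1 / r) *\<^sub>R (dagger Y ** transfer (dagger \<circ> T) g ** Y)"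
  proof -
    have "linear (\<lambda>X. (1 / r) *\<^sub>R (dagger Y ** X ** Y))"
      by (intro linear_compose_scale_right linear_sandwich)
    from linear_sum[OF this, of "\<lambda>j. dagger (T j) ** g ** T j" UNIV] show ?thesis
      by (simp add: transfer_def)
  qed
  also have "\<dots> = (1 / r * r) *\<^sub>R (dagger Y ** g ** Y)"
    unfolding g(3) by (simp only: matrix_scalar_ac scalar_matrix_assoc[symmetric] scaleR_scaleR)
  \<comment> \<open>One factor \<open>Z\<close> of \<open>g\<close> cancels against
    \<open>dagger Y\<close>, the other against \<open>Y\<close>.\<close>
  also have "dagger Y ** g ** Y = (dagger Y ** Z) ** (Z ** Y)"
    by (simp only: matrix_mul_assoc Z(2)[symmetric])
  finally have "transfer (dagger \<circ> S) (mat 1) = mat 1"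
    using g(2) by (simp add: dY ZY o_def)
  then have "trace (transfer S f) = trace f" for f
    by (simp add: trace_transfer)
  with rep spanS that show thesis by blast
qed

section \<open>Exponential convergence to the fixed point\<close>

text \<open>Doeblin's minorization: the image of \<open>f\<close> dominates \<open>\<delta>\<close>
  times its trace times the identity. Here \<open>\<delta>\<close> is the minimum of the form over
  the compact product of density matrices and unit sphere, positive by
  \<open>transfer_posdef\<close>; homogeneity in \<open>f\<close> and \<open>v\<close> covers the
  rest.\<close>

lemma transfer_lower_bound:
  fixes T :: "'d::finite \<Rightarrow> complex^'n^'n"
  assumes span: "cmat.span (range T) = UNIV"
  obtains \<delta> where "\<delta> > 0"
    "\<And>f v. psd f \<Longrightarrow> \<delta> * Re (trace f) * (v \<bullet> v) \<le> v \<bullet> (transfer T f *v v)"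
proof -
  let ?K = "{f :: complex^'n^'n. density_matrix f} \<times> sphere (0 :: complex^'n) 1"
  have lin: "linear (transfer T)" by (rule linear_transfer)
  have "compact ?K" by (intro compact_Times compact_density) auto
  moreover have "?K \<noteq> {}"
    using density_nonempty[where 'n = 'n] by auto
  moreover have "continuous_on ?K (\<lambda>p. snd p \<bullet> (transfer T (fst p) *v snd p))"
    by (intro continuous_intros linear_continuous_on_compose[OF _ lin])
  ultimately obtain p where p: "p \<in> ?K"
    "\<And>q. q \<in> ?K \<Longrightarrow> snd p \<bullet> (transfer T (fst p) *v snd p) \<le> snd q \<bullet> (transfer T (fst q) *v snd q)"
    using continuous_attains_inf[of ?K "\<lambda>p. snd p \<bullet> (transfer T (fst p) *v snd p)"] by blast
  define \<delta> where "\<delta> = snd p \<bullet> (transfer T (fst p) *v snd p)"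
  have "density_matrix (fst p)" "snd p \<noteq> 0" using p(1) by auto
  then have "\<delta> > 0"
    using transfer_posdef[OF span] unfolding \<delta>_def posdef_def by blast
  moreover have "\<delta> * Re (trace f) * (v \<bullet> v) \<le> v \<bullet> (transfer T f *v v)" if f: "psd f" for f v
  proof (cases "trace f = 0 \<or> v = 0")
    case True
    then show ?thesis
      using psd_transfer[OF f, of T] unfolding psd_def by (metis inner_zero_left mult_zero_left mult_zero_right zero_complex.simps(1))
  next
    case False
    define t where "t = Re (trace f)"
    have t: "t > 0" "density_matrix ((1 / t) *\<^sub>R f)"
      using psd_density_scale[OF f] False by (auto simp: t_def)
    have nv: "norm v > 0" using False by simp
    define w where "w = (1 / norm v) *\<^sub>R v"
    have "w \<in> sphere 0 1" using nv by (simp add: w_def)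
    then have "\<delta> \<le> w \<bullet> (transfer T ((1 / t) *\<^sub>R f) *v w)"
      using p(2)[of "((1 / t) *\<^sub>R f, w)"] t by (simp add: \<delta>_def)
    also have "\<dots> = v \<bullet> (transfer T f *v v) / (t * (norm v)\<^sup>2)"
      by (simp add: linear_cmul[OF lin] scaleR_mult_vec w_def mult_vec_scaleR power2_eq_square)
    finally have "\<delta> * (t * (norm v)\<^sup>2) \<le> v \<bullet> (transfer T f *v v)"
      using t(1) nv by (simp add: pos_le_divide_eq)
    then show ?thesis by (simp add: t_def power2_norm_eq_inner mult.assoc)
  qed
  ultimately show thesis by (rule that)
qed

lemma matrix_add_right: "(A + B) ** C = A ** C + B ** (C :: complex^'n^'m)"
  by (simp add: vec_eq_iff matrix_matrix_mult_def algebra_simps sum.distrib)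

text \<open>Weighting \<open>P \<omega>\<close> by \<open>\<omega>\<close> and summing over the four
  fourth roots of unity leaves only the term \<open>4 X\<close>. An estimate stable under complex
  linear combinations therefore needs checking only on positive semidefinite matrices.\<close>

lemma psd_polarization:
  fixes X :: "complex^'n^'n"
  defines "P \<equiv> \<lambda>\<omega>. (X + mat_scale \<omega> (mat 1)) ** dagger (X + mat_scale \<omega> (mat 1))"
  shows "X = mat_scale (1/4) (P 1 + mat_scale \<i> (P \<i>) + mat_scale (-1) (P (-1)) + mat_scale (-\<i>) (P (-\<i>)))"
    and "psd (P \<omega>)"
proof -
  have P: "P \<omega> = X ** dagger X + mat_scale (cnj \<omega>) X + mat_scale \<omega> (dagger X)
      + mat_scale (\<omega> * cnj \<omega>) (mat 1)" for \<omega>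
    by (simp add: P_def dagger_add dagger_mat_scale matrix_add_ldistrib matrix_add_right
        mat_scale_mult_left mat_scale_mult_right) (simp add: vec_eq_iff algebra_simps)
  show "X = mat_scale (1/4) (P 1 + mat_scale \<i> (P \<i>) + mat_scale (-1) (P (-1)) + mat_scale (-\<i>) (P (-\<i>)))"
    unfolding P by (simp add: vec_eq_iff algebra_simps)
  have "psd (mat 1 :: complex^'n^'n)" by (simp add: psd_def)
  from psd_congruence[OF this] show "psd (P \<omega>)" by (simp add: P_def)
qed

text \<open>Doeblin's argument: subtracting \<open>\<delta> tr(f) 1\<close> from the channel leaves a positive map that
  multiplies traces by \<open>1 - \<delta>D\<close> and agrees with the channel on traceless matrices.\<close>

lemma traceless_decay:
  fixes S :: "'d::finite \<Rightarrow> complex^'n^'n"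
  assumes span: "cmat.span (range S) = UNIV" and tp: "\<And>f. trace (transfer S f) = trace f"
  obtains \<gamma> where "0 < \<gamma>" "\<gamma> < 1"
    "\<And>X. trace X = 0 \<Longrightarrow> \<exists>C. \<forall>m i j. cmod ((transfer S ^^ m) X $ i $ j) \<le> C * \<gamma> ^ m"
proof -
  define D where "D = real CARD('n)"
  have D: "D > 0" by (simp add: D_def)
  obtain \<delta>\<^sub>0 where \<delta>\<^sub>0: "\<delta>\<^sub>0 > 0"
    "\<And>f v. psd f \<Longrightarrow> \<delta>\<^sub>0 * Re (trace f) * (v \<bullet> v) \<le> v \<bullet> (transfer S f *v v)"
    using transfer_lower_bound[OF span] by blast
  \<comment> \<open>The cap \<open>1 / (2 * D)\<close> keeps
    \<open>\<gamma> = 1 - \<delta> * D\<close> at least one half, hence positive.\<close>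
  define \<delta> where "\<delta> = min \<delta>\<^sub>0 (1 / (2 * D))"
  have \<delta>: "0 < \<delta>" "\<delta> \<le> \<delta>\<^sub>0" "\<delta> \<le> 1 / (2 * D)" using \<delta>\<^sub>0(1) D by (auto simp: \<delta>_def)
  define \<gamma> where "\<gamma> = 1 - \<delta> * D"
  have "\<delta> * D \<le> 1 / 2" using \<delta>(3) D by (simp add: field_simps)
  then have \<gamma>: "0 < \<gamma>" "\<gamma> < 1" using \<delta>(1) D by (auto simp: \<gamma>_def)
  define G where "G f = transfer S f - mat_scale (of_real \<delta> * trace f) (mat 1)" for f
  have G_trace: "trace (G f) = of_real \<gamma> * trace f" for f
    by (simp add: G_def trace_sub tp trace_mat_scale trace_I \<gamma>_def D_def algebra_simps)
  have G_psd: "psd (G f)" if f: "psd f" for f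
  proof -
    have tr: "of_real \<delta> * trace f = of_real (\<delta> * Re (trace f))"
      using psd_trace(2)[OF f] by (metis of_real_mult)
    have eq: "G f = transfer S f - (\<delta> * Re (trace f)) *\<^sub>R mat 1"
      unfolding G_def tr mat_scale_of_real ..
    have "dagger (G f) = G f"
      using psd_transfer[OF f, of S] by (simp add: eq psd_def dagger_diff dagger_scaleR)
    moreover have "0 \<le> v \<bullet> (G f *v v)" for v
    proof -
      have "\<delta> * Re (trace f) * (v \<bullet> v) \<le> \<delta>\<^sub>0 * Re (trace f) * (v \<bullet> v)"
        using psd_trace(1)[OF f] \<delta>(2) by (intro mult_right_mono) auto
      also have "\<dots> \<le> v \<bullet> (transfer S f *v v)" by (rule \<delta>\<^sub>0(2)[OF f])
      finally show ?thesis
        by (simp add: eq matrix_vector_mult_diff_rdistrib scaleR_mult_vec inner_diff_right)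
    qed
    ultimately show ?thesis by (simp add: psd_def)
  qed
  have G_add: "G (X + Y) = G X + G Y" for X Y
    by (simp add: G_def linear_add[OF linear_transfer] trace_add vec_eq_iff algebra_simps)
  have G_scale: "G (mat_scale a X) = mat_scale a (G X)" for a X
    by (simp add: G_def transfer_mat_scale trace_mat_scale vec_eq_iff algebra_simps)
  have Gm_add: "(G ^^ m) (X + Y) = (G ^^ m) X + (G ^^ m) Y" for m X Y
    by (induction m) (simp_all add: G_add)
  have Gm_scale: "(G ^^ m) (mat_scale a X) = mat_scale a ((G ^^ m) X)" for m a X
    by (induction m) (simp_all add: G_scale)
  define decays where "decays X \<longleftrightarrow> (\<exists>C. \<forall>m i j. cmod ((G ^^ m) X $ i $ j) \<le> C * \<gamma> ^ m)" for X
  have decays_psd: "decays X" if "psd X" for X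
  proof -
    \<comment> \<open>Iterates stay positive semidefinite while their traces shrink geometrically,
      and the trace bounds every entry.\<close>
    have "psd ((G ^^ m) X) \<and> trace ((G ^^ m) X) = of_real (\<gamma> ^ m) * trace X" for m
      by (induction m) (use that in \<open>auto simp: G_psd G_trace\<close>)
    then have "cmod ((G ^^ m) X $ i $ j) \<le> Re (trace X) * \<gamma> ^ m" for m i j
      using psd_entry_le_trace[of "(G ^^ m) X" i j] by (simp add: mult.commute)
    then show ?thesis unfolding decays_def by blast
  qed
  have decays_add: "decays (X + Y)" if "decays X" "decays Y" for X Y
  proof -
    obtain C where C: "\<And>m i j. cmod ((G ^^ m) X $ i $ j) \<le> C * \<gamma> ^ m"
      using \<open>decays X\<close> unfolding decays_def by blast
    obtain C' where C': "\<And>m i j. cmod ((G ^^ m) Y $ i $ j) \<le> C' * \<gamma> ^ m"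
      using \<open>decays Y\<close> unfolding decays_def by blast
    have "cmod ((G ^^ m) (X + Y) $ i $ j) \<le> (C + C') * \<gamma> ^ m" for m i j
      using norm_triangle_ineq[of "(G ^^ m) X $ i $ j" "(G ^^ m) Y $ i $ j"] C[of m i j] C'[of m i j]
      by (simp add: Gm_add distrib_right)
    then show ?thesis unfolding decays_def by blast
  qed
  have decays_scale: "decays (mat_scale a X)" if "decays X" for a X
  proof -
    obtain C where C: "\<And>m i j. cmod ((G ^^ m) X $ i $ j) \<le> C * \<gamma> ^ m"
      using \<open>decays X\<close> unfolding decays_def by blast
    have "cmod ((G ^^ m) (mat_scale a X) $ i $ j) \<le> (cmod a * C) * \<gamma> ^ m" for m i j
      using mult_left_mono[OF C[of m i j], of "cmod a"]
      by (simp add: Gm_scale norm_mult mult.assoc)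
    then show ?thesis unfolding decays_def by blast
  qed
  have decays: "decays X" for X
    by (subst psd_polarization(1))
      (intro decays_scale decays_add decays_psd psd_polarization(2))
  have "\<exists>C. \<forall>m i j. cmod ((transfer S ^^ m) X $ i $ j) \<le> C * \<gamma> ^ m" if "trace X = 0" for X
  proof -
    \<comment> \<open>Trace preservation keeps every iterate traceless, so the term subtracted in
      \<open>G\<close> vanishes each time.\<close>
    have "trace ((transfer S ^^ m) X) = 0 \<and> (G ^^ m) X = (transfer S ^^ m) X" for m
      by (induction m) (use that in \<open>auto simp: tp G_def\<close>)
    then show ?thesis using decays[of X] unfolding decays_def by simp
  qed
  with \<gamma> that show thesis by blast
qed

section \<open>Boundary states and their limit\<close>

text \<open>The blocks of \<open>ket_bra Omega\<close> with fixed second indices are the matrix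
  units. The boundary state thus collects the images of all matrix units under the iterated
  channel.\<close>

lemma boundary_state_nth:
  "boundary_state S m $ p $ q =
    (transfer S ^^ m) (\<chi> a b. if a = snd p \<and> b = snd q then 1 else 0) $ fst p $ fst q"
proof -
  have "(\<chi> a b. ket_bra Omega $ (a, snd p) $ (b, snd q))
      = (\<chi> a b. if a = snd p \<and> b = snd q then 1 else (0::complex))"
    by (simp add: vec_eq_iff ket_bra_def Omega_def)
  then show ?thesis by (simp add: boundary_state_def map_tensor_id_def)
qed

text \<open>The channel commutes with the adjoint, and the adjoint swaps the two indices of a matrix
  unit.\<close>

lemma dagger_boundary_state: "dagger (boundary_state S m) = boundary_state S m"
proof -
  have pow: "(transfer S ^^ m) (dagger X) = dagger ((transfer S ^^ m) X)" for X
    by (induction m) (simp_all add: transfer_dagger)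
  have unit: "dagger (\<chi> a b. if a = k \<and> b = l then 1 else 0)
      = (\<chi> a b. if a = l \<and> b = k then 1 else (0::complex))" for k l
    by (auto simp: vec_eq_iff)
  have "cnj (boundary_state S m $ q $ p) = boundary_state S m $ p $ q" for p q
    unfolding boundary_state_nth dagger_nth[symmetric] pow[symmetric] unit ..
  then show ?thesis by (simp add: vec_eq_iff)
qed

text \<open>Each matrix unit is its trace times \<open>\<sigma>\<close>, which the channel fixes,
  plus a traceless remainder, which decays. The traces are Kronecker deltas, so the fixed parts
  assemble to \<open>kron \<sigma> (mat 1)\<close>.\<close>

lemma boundary_state_limit:
  fixes S :: "'d::finite \<Rightarrow> complex^'n^'n"
  assumes span: "cmat.span (range S) = UNIV" and tp: "\<And>f. trace (transfer S f) = trace f"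
  obtains \<sigma> \<gamma> C where "density_matrix \<sigma>" "posdef \<sigma>" "0 < \<gamma>" "\<gamma> < 1"
    "\<And>m p q. cmod ((boundary_state S m - kron \<sigma> (mat 1)) $ p $ q) \<le> C * \<gamma> ^ m"
proof -
  obtain \<sigma> r where \<sigma>: "density_matrix \<sigma>" "posdef \<sigma>" and r: "transfer S \<sigma> = r *\<^sub>R \<sigma>"
    using perron_eigenmatrix[OF span] by blast
  have tr\<sigma>: "trace \<sigma> = 1" using \<sigma>(1) by (simp add: density_matrix_def)
  \<comment> \<open>Comparing traces in the eigenvalue equation determines \<open>r\<close>.\<close>
  have "complex_of_real r = 1"
    using tp[of \<sigma>] by (simp add: r tr\<sigma> trace_scaleR scaleR_conv_of_real[where 'a = complex])
  then have fix1: "transfer S \<sigma> = \<sigma>" using r by simp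
  have fixm: "(transfer S ^^ m) (mat_scale a \<sigma>) = mat_scale a \<sigma>" for m a
    by (induction m) (simp_all add: transfer_mat_scale fix1)
  obtain \<gamma> where \<gamma>: "0 < \<gamma>" "\<gamma> < 1"
    "\<And>X. trace X = 0 \<Longrightarrow> \<exists>C. \<forall>m i j. cmod ((transfer S ^^ m) X $ i $ j) \<le> C * \<gamma> ^ m"
    using traceless_decay[OF span tp] by blast
  define E :: "'n \<Rightarrow> 'n \<Rightarrow> complex^'n^'n" where "E k l = (\<chi> a b. if a = k \<and> b = l then 1 else 0)" for k l
  define X where "X k l = E k l - mat_scale (trace (E k l)) \<sigma>" for k l
  have "trace (X k l) = 0" for k l by (simp add: X_def trace_sub trace_mat_scale tr\<sigma>)
  then have "\<forall>k l. \<exists>C. \<forall>m i j. cmod ((transfer S ^^ m) (X k l) $ i $ j) \<le> C * \<gamma> ^ m"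
    using \<gamma>(3) by blast
  then obtain C where C: "\<And>k l m i j. cmod ((transfer S ^^ m) (X k l) $ i $ j) \<le> C k l * \<gamma> ^ m"
    by metis
  have C0: "0 \<le> C k l" for k l
    using C[of 0 k l] by (metis mult.right_neutral norm_ge_zero order_trans power_0)
  \<comment> \<open>Summing the nonnegative constants yields one that is uniform over all matrix
    units.\<close>
  define C' where "C' = (\<Sum>k\<in>UNIV. \<Sum>l\<in>UNIV. C k l)"
  have CC': "C k l \<le> C'" for k l
  proof -
    have "C k l \<le> (\<Sum>l\<in>UNIV. C k l)" by (rule member_le_sum) (auto simp: C0)
    also have "\<dots> \<le> C'" unfolding C'_def
      by (rule member_le_sum) (auto simp: C0 sum_nonneg)
    finally show ?thesis .
  qed
  have trE: "trace (E k l) = (if k = l then 1 else 0)" for k l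
  proof -
    have "trace (E k l) = (\<Sum>i\<in>UNIV. if i = k then (if k = l then 1 else 0) else 0)"
      unfolding trace_def by (rule sum.cong) (auto simp: E_def)
    then show ?thesis by simp
  qed
  have "cmod ((boundary_state S m - kron \<sigma> (mat 1)) $ p $ q) \<le> C' * \<gamma> ^ m" for m p q
  proof -
    have diff: "(transfer S ^^ m) (A - B) = (transfer S ^^ m) A - (transfer S ^^ m) B" for A B
      by (induction m) (simp_all add: linear_diff[OF linear_transfer])
    have "(boundary_state S m - kron \<sigma> (mat 1)) $ p $ q
        = (transfer S ^^ m) (X (snd p) (snd q)) $ fst p $ fst q"
      by (simp add: X_def diff fixm boundary_state_nth E_def[symmetric] trE kron_def mat_def)
    also have "cmod \<dots> \<le> C (snd p) (snd q) * \<gamma> ^ m" by (rule C)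
    also have "\<dots> \<le> C' * \<gamma> ^ m" using \<gamma>(1) by (intro mult_right_mono CC') auto
    finally show ?thesis .
  qed
  with \<sigma> \<gamma>(1,2) that show thesis by blast
qed

section \<open>Operator norm estimates\<close>

lemma norm_mult_vec_le_entries:
  fixes A :: "complex^'n^'m"
  assumes "\<And>i j. cmod (A $ i $ j) \<le> e"
  shows "norm (A *v x) \<le> real CARD('m) * real CARD('n) * e * norm x"
proof -
  have "norm (A *v x) \<le> (\<Sum>i\<in>UNIV. cmod ((A *v x) $ i))"
    unfolding norm_vec_def[of "A *v x"] by (rule L2_set_le_sum) auto
  also have "\<dots> \<le> (\<Sum>i::'m\<in>UNIV. \<Sum>j::'n\<in>UNIV. e * norm x)"
  proof (rule sum_mono)
    fix i
    have "cmod ((A *v x) $ i) \<le> (\<Sum>j\<in>UNIV. cmod (A $ i $ j * x $ j))"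
      by (simp add: matrix_vector_mult_def norm_sum)
    also have "\<dots> \<le> (\<Sum>j::'n\<in>UNIV. e * norm x)"
      unfolding norm_mult
      by (intro sum_mono mult_mono assms Finite_Cartesian_Product.norm_nth_le)
        (use order_trans[OF norm_ge_zero assms] in auto)
    finally show "cmod ((A *v x) $ i) \<le> (\<Sum>j::'n\<in>UNIV. e * norm x)" .
  qed
  also have "\<dots> = real CARD('m) * real CARD('n) * e * norm x" by simp
  finally show ?thesis .
qed

section \<open>Tensoring with the identity\<close>

lemma sum_UNIV_prod: "(\<Sum>x\<in>UNIV. h x) = (\<Sum>a\<in>UNIV. \<Sum>b\<in>UNIV. h (a, b))"
  by (simp add: sum.cartesian_product)

lemma kron_mat_1_nth: "kron A (mat 1) $ (i, k) $ (j, l) = (if k = l then A $ i $ j else 0)"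
  by (simp add: kron_def mat_def)

lemma kron_mat_1_mult: "kron A (mat 1) ** kron B (mat 1) = kron (A ** B) (mat 1 :: complex^'q^'q)"
proof -
  have "(kron A (mat 1 :: complex^'q^'q) ** kron B (mat 1)) $ (i, k) $ (j, l)
      = kron (A ** B) (mat 1 :: complex^'q^'q) $ (i, k) $ (j, l)" for i k j l
  proof -
    have "kron A (mat 1 :: complex^'q^'q) $ (i, k) $ (a, b) * kron B (mat 1) $ (a, b) $ (j, l)
        = (if k = b then A $ i $ a * (if k = l then B $ a $ j else 0) else 0)" for a b
      by (simp add: kron_mat_1_nth)
    then show ?thesis
      by (simp add: matrix_matrix_mult_def sum_UNIV_prod) (simp add: kron_mat_1_nth)
  qed
  then show ?thesis by (simp add: vec_eq_iff)
qed

lemma kron_mat_1_mat_1: "kron (mat 1) (mat 1) = mat 1"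
  by (auto simp: kron_def mat_def vec_eq_iff prod_eq_iff)

text \<open>The matrix acts as \<open>A\<close> on each slice of \<open>v\<close> with fixed second
  index, and inner products are sums over slices.\<close>

lemma kron_mat_1_lower_bound:
  fixes A :: "complex^'n^'n" and v :: "complex^('n \<times> 'q::finite)"
  assumes "\<And>w. s * (w \<bullet> w) \<le> w \<bullet> (A *v w)"
  shows "s * (v \<bullet> v) \<le> v \<bullet> (kron A (mat 1) *v v)"
proof -
  define slice :: "'q \<Rightarrow> complex^('n \<times> 'q) \<Rightarrow> complex^'n" where "slice k u = (\<chi> a. u $ (a, k))" for k u
  have inner: "u \<bullet> w = (\<Sum>k\<in>UNIV. slice k u \<bullet> slice k w)" for u w :: "complex^('n \<times> 'q)"
    unfolding inner_vec_def sum_UNIV_prod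
    by (subst sum.swap) (simp add: slice_def)
  have "slice k (kron A (mat 1) *v v) = A *v slice k v" for k
  proof -
    have "kron A (mat 1) $ (a, k) $ (b, l) * v $ (b, l) = (if k = l then A $ a $ b * v $ (b, k) else 0)"
      for a b l
      by (simp add: kron_mat_1_nth)
    then show ?thesis
      by (simp add: slice_def matrix_vector_mult_def vec_eq_iff sum_UNIV_prod)
  qed
  then show ?thesis
    using assms by (simp add: inner sum_distrib_left sum_mono)
qed

text \<open>The smallness of \<open>e\<close> confines the form of \<open>\<rho>\<close> between
  \<open>s / 2\<close> and \<open>M + s / 2\<close> times \<open>v \<bullet> v\<close>. That form is
  the squared norm of \<open>mat_sqrt \<rho> *v v\<close>, so the root is bounded by
  \<open>sqrt (M + s / 2)\<close> and its inverse by \<open>sqrt (2 / s)\<close>. Both differences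
  are products with one factor \<open>\<rho> - \<Sigma>\<close> up to sign.\<close>

lemma sqrt_sandwich_estimates:
  fixes \<rho> \<Sigma> K :: "complex^'k^'k"
  assumes herm: "dagger \<rho> = \<rho>" and inv: "K ** \<Sigma> = mat 1"
    and s: "s > 0" "\<And>v. s * (v \<bullet> v) \<le> v \<bullet> (\<Sigma> *v v)"
    and M: "\<And>v. norm (\<Sigma> *v v) \<le> M * norm v" and L: "\<And>v. norm (K *v v) \<le> L * norm v" "L \<ge> 0"
    and e: "\<And>v. norm ((\<rho> - \<Sigma>) *v v) \<le> e * norm v" "0 \<le> e" "e \<le> s / 2"
  shows "invertible (mat_sqrt \<rho>)"
    and "opnorm (mat_sqrt \<rho> ** K ** mat_sqrt \<rho> - mat 1) \<le> sqrt (M + s / 2) * L * sqrt (2 / s) * e"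
    and "opnorm (matrix_inv (mat_sqrt \<rho>) ** \<Sigma> ** matrix_inv (mat_sqrt \<rho>) - mat 1) \<le> 2 / s * e"
proof -
  have \<rho>: "v \<bullet> (\<rho> *v v) = v \<bullet> (\<Sigma> *v v) + v \<bullet> ((\<rho> - \<Sigma>) *v v)" for v
    by (simp add: matrix_vector_mult_diff_rdistrib inner_diff_right)
  have small: "\<bar>v \<bullet> ((\<rho> - \<Sigma>) *v v)\<bar> \<le> s / 2 * (v \<bullet> v)" for v
  proof -
    have "\<bar>v \<bullet> ((\<rho> - \<Sigma>) *v v)\<bar> \<le> norm v * norm ((\<rho> - \<Sigma>) *v v)" by (rule Cauchy_Schwarz_ineq2)
    also have "\<dots> \<le> norm v * (s / 2 * norm v)"
      using e(1)[of v] mult_right_mono[OF e(3), of "norm v"] by (intro mult_left_mono) auto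
    also have "\<dots> = s / 2 * (v \<bullet> v)" unfolding dot_square_norm by (simp add: power2_eq_square)
    finally show ?thesis .
  qed
  have lower: "s / 2 * (v \<bullet> v) \<le> v \<bullet> (\<rho> *v v)" for v
    using s(2)[of v] small[of v] unfolding \<rho> by linarith
  have upper: "v \<bullet> (\<rho> *v v) \<le> (M + s / 2) * (v \<bullet> v)" for v
  proof -
    have "v \<bullet> (\<Sigma> *v v) \<le> norm v * norm (\<Sigma> *v v)" by (rule norm_cauchy_schwarz)
    also have "\<dots> \<le> norm v * (M * norm v)" by (intro mult_left_mono M) auto
    also have "\<dots> = M * (v \<bullet> v)" unfolding dot_square_norm by (simp add: power2_eq_square)
    finally show ?thesis using small[of v] unfolding \<rho> distrib_right by linarith
  qed
  have pd: "posdef \<rho>"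
    unfolding posdef_def using herm lower s(1)
    by (metis inner_gt_zero_iff half_gt_zero less_le_trans mult_pos_pos)
  define B where "B = mat_sqrt \<rho>"
  define J where "J = matrix_inv B"
  have B: "dagger B = B" "B ** B = \<rho>" and Binv: "invertible B"
    using mat_sqrt_posdef[OF pd] mat_sqrt_invertible[OF pd] by (auto simp: B_def psd_def)
  then show "invertible (mat_sqrt \<rho>)" by (simp add: B_def)
  have BJ: "B ** J = mat 1" "J ** B = mat 1"
    using matrix_inv_invertible[OF Binv] by (auto simp: J_def)
  have normB: "(norm (B *v v))\<^sup>2 = v \<bullet> (\<rho> *v v)" for v
    unfolding power2_norm_eq_inner using inner_hermitian[OF B(1), of v "B *v v"]
    by (simp add: matrix_vector_mul_assoc B(2))
  have B_le: "norm (B *v v) \<le> sqrt (M + s / 2) * norm v" for v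
    using real_sqrt_le_mono[OF upper[of v]] unfolding normB[symmetric] real_sqrt_mult
    by (simp add: norm_eq_sqrt_inner)
  have J_le: "norm (J *v w) \<le> sqrt (2 / s) * norm w" for w
  proof -
    have "B *v (J *v w) = w" by (simp add: matrix_vector_mul_assoc BJ)
    then have "s / 2 * (norm (J *v w))\<^sup>2 \<le> (norm w)\<^sup>2"
      using lower[of "J *v w"] normB[of "J *v w"] by (simp add: power2_norm_eq_inner)
    then have "(norm (J *v w))\<^sup>2 \<le> 2 / s * (norm w)\<^sup>2"
      using s(1) by (simp add: field_simps)
    from real_sqrt_le_mono[OF this] show ?thesis unfolding real_sqrt_mult by simp
  qed
  \<comment> \<open>Multiply out, using \<open>B ** B = \<rho>\<close>,
    \<open>B ** J = mat 1\<close> and \<open>K ** \<Sigma> = mat 1\<close>.\<close>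
  have "B ** K ** B - mat 1 = B ** (K ** ((\<rho> - \<Sigma>) ** J))"
  proof -
    have "B ** (K ** ((\<rho> - \<Sigma>) ** J)) = B ** K ** B ** (B ** J) - B ** (K ** \<Sigma>) ** J"
      unfolding B(2)[symmetric] by (simp add: matrix_diff_left matrix_diff_right matrix_mul_assoc)
    then show ?thesis by (simp add: BJ inv)
  qed
  then have eq1: "(B ** K ** B - mat 1) *v v = B *v (K *v ((\<rho> - \<Sigma>) *v (J *v v)))" for v
    by (simp only: matrix_vector_mul_assoc)
  \<comment> \<open>\<open>M\<close> comes without a sign and \<open>sqrt\<close> is negative at
    negative arguments; evaluating \<open>B_le\<close> at a nonzero vector settles the sign.\<close>
  have sq: "0 \<le> sqrt (M + s / 2)"
    using B_le[of "axis undefined 1"] by (smt (verit) norm_ge_zero mult_nonneg_nonneg mult_neg_pos zero_less_norm_iff axis_eq_0_iff zero_neq_one)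
  show "opnorm (mat_sqrt \<rho> ** K ** mat_sqrt \<rho> - mat 1) \<le> sqrt (M + s / 2) * L * sqrt (2 / s) * e"
    unfolding opnorm_def B_def[symmetric]
  proof (rule onorm_le)
    fix v
    have "norm (B *v (K *v ((\<rho> - \<Sigma>) *v (J *v v)))) \<le> sqrt (M + s / 2) * (L * (e * (sqrt (2 / s) * norm v)))"
      by (rule order_trans[OF B_le mult_left_mono[OF _ sq]],
          rule order_trans[OF L(1) mult_left_mono[OF _ L(2)]],
          rule order_trans[OF e(1) mult_left_mono[OF J_le e(2)]])
    then show "norm ((B ** K ** B - mat 1) *v v) \<le> sqrt (M + s / 2) * L * sqrt (2 / s) * e * norm v"
      unfolding eq1 by (simp add: mult_ac)
  qed
  have "J ** \<Sigma> ** J - mat 1 = J ** ((\<Sigma> - \<rho>) ** J)"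
  proof -
    have "J ** ((\<Sigma> - \<rho>) ** J) = J ** \<Sigma> ** J - (J ** B) ** (B ** J)"
      unfolding B(2)[symmetric] by (simp add: matrix_diff_left matrix_diff_right matrix_mul_assoc)
    then show ?thesis by (simp add: BJ)
  qed
  then have eq2: "(J ** \<Sigma> ** J - mat 1) *v v = J *v ((\<Sigma> - \<rho>) *v (J *v v))" for v
    by (simp only: matrix_vector_mul_assoc)
  have e': "norm ((\<Sigma> - \<rho>) *v v) \<le> e * norm v" for v
    using e(1)[of v] by (simp add: matrix_vector_mult_diff_rdistrib norm_minus_commute)
  have s2: "0 \<le> sqrt (2 / s)" using s(1) by simp
  show "opnorm (matrix_inv (mat_sqrt \<rho>) ** \<Sigma> ** matrix_inv (mat_sqrt \<rho>) - mat 1) \<le> 2 / s * e"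
    unfolding opnorm_def B_def[symmetric] J_def[symmetric]
  proof (rule onorm_le)
    fix v
    have "norm (J *v ((\<Sigma> - \<rho>) *v (J *v v))) \<le> sqrt (2 / s) * (e * (sqrt (2 / s) * norm v))"
      by (rule order_trans[OF J_le mult_left_mono[OF _ s2]],
          rule order_trans[OF e' mult_left_mono[OF J_le e(2)]])
    also have "\<dots> = (sqrt (2 / s) * sqrt (2 / s)) * e * norm v" by (simp only: mult_ac)
    also have "sqrt (2 / s) * sqrt (2 / s) = 2 / s" using s(1) by simp
    finally show "norm ((J ** \<Sigma> ** J - mat 1) *v v) \<le> 2 / s * e * norm v"
      unfolding eq2 .
  qed
qed

section \<open>Final assembly\<close>

text \<open>The perturbation estimates start only once the boundary state is close to its limit,
  whereas the first claim concerns every \<open>m\<close>. The finitely many earlier values, divided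
  by their powers of \<open>\<gamma>\<close>, are absorbed into the constant.\<close>

lemma eventually_geometric_bound_all:
  fixes a :: "nat \<Rightarrow> real"
  assumes ev: "\<forall>\<^sub>F m in sequentially. a m \<le> b * \<gamma> ^ m" and \<gamma>: "\<gamma> > 0"
  obtains c where "c > 0" "\<And>m. a m \<le> c * \<gamma> ^ m"
proof -
  obtain N where N: "\<And>m. m \<ge> N \<Longrightarrow> a m \<le> b * \<gamma> ^ m"
    using ev unfolding eventually_sequentially by blast
  define c where "c = \<bar>b\<bar> + 1 + (\<Sum>m<N. \<bar>a m\<bar> / \<gamma> ^ m)"
  have nn: "0 \<le> (\<Sum>m<N. \<bar>a m\<bar> / \<gamma> ^ m)" using \<gamma> by (intro sum_nonneg) auto
  have "a m \<le> c * \<gamma> ^ m" for m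
  proof (cases "m < N")
    case True
    have "\<bar>a m\<bar> / \<gamma> ^ m \<le> (\<Sum>m<N. \<bar>a m\<bar> / \<gamma> ^ m)"
      using True \<gamma> by (intro member_le_sum) auto
    then have "\<bar>a m\<bar> / \<gamma> ^ m \<le> c" by (simp add: c_def)
    then show ?thesis using \<gamma> by (simp add: pos_divide_le_eq)
  next
    case False
    then have "a m \<le> b * \<gamma> ^ m" using N by simp
    also have "\<dots> \<le> c * \<gamma> ^ m" using nn \<gamma> by (intro mult_right_mono) (auto simp: c_def)
    finally show ?thesis .
  qed
  moreover have "c > 0" using nn by (simp add: c_def)
  ultimately show thesis using that by blast
qed

text \<open>Invertibility of the root is asserted along with the second estimate because
  \<open>matrix_inv\<close> of a singular matrix is an arbitrary choice.\<close>

theorem mainTheorem6: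
  fixes T :: "'d::finite \<Rightarrow> complex^'n^'n"
  assumes "mps_injective T"
  shows "\<exists>(S :: 'd \<Rightarrow> complex^'n^'n) (\<sigma> :: complex^'n^'n) (c :: real) (c' :: real) (\<gamma> :: real).
    mps_representation T S \<and>
    density_matrix \<sigma> \<and> rank \<sigma> = CARD('n) \<and>
    c > 0 \<and> c' > 0 \<and> 0 < \<gamma> \<and> \<gamma> < 1 \<and>
    (\<forall>m. opnorm (mat_sqrt (boundary_state S m) ** kron (matrix_inv \<sigma>) (mat 1)
                   ** mat_sqrt (boundary_state S m) - mat 1)
           \<le> c * inverse (min_eigenvalue \<sigma>) * \<gamma> ^ m) \<and>
    (\<forall>\<^sub>F m in sequentially.
       invertible (mat_sqrt (boundary_state S m)) \<and>
       opnorm (matrix_inv (mat_sqrt (boundary_state S m)) ** kron \<sigma> (mat 1)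
                 ** matrix_inv (mat_sqrt (boundary_state S m)) - mat 1)
         \<le> c' * inverse (min_eigenvalue \<sigma>) * \<gamma> ^ m)"
proof -
  obtain S where rep: "mps_representation T S" and span: "cmat.span (range S) = UNIV"
    and tp: "\<And>f. trace (transfer S f) = trace f"
    using trace_preserving_gauge[OF mps_injective_span[OF assms]] by blast
  obtain \<sigma> \<gamma> C where \<sigma>: "density_matrix \<sigma>" "posdef \<sigma>" and \<gamma>: "0 < \<gamma>" "\<gamma> < 1"
    and C: "\<And>m p q. cmod ((boundary_state S m - kron \<sigma> (mat 1)) $ p $ q) \<le> C * \<gamma> ^ m"
    using boundary_state_limit[OF span tp] by blast
  let ?\<rho> = "boundary_state S"
  let ?\<Sigma> = "kron \<sigma> (mat 1) :: complex^('n \<times> 'n)^('n \<times> 'n)"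
  let ?K = "kron (matrix_inv \<sigma>) (mat 1) :: complex^('n \<times> 'n)^('n \<times> 'n)"
  define l where "l = min_eigenvalue \<sigma>"
  have l: "l > 0" unfolding l_def by (rule min_eigenvalue_posdef[OF \<sigma>(2)])
  have \<sigma>inv: "invertible \<sigma>" by (rule posdef_imp_invertible[OF \<sigma>(2)])
  have inv: "?K ** ?\<Sigma> = mat 1"
    by (simp add: kron_mat_1_mult matrix_inv_invertible[OF \<sigma>inv] kron_mat_1_mat_1)
  obtain s where s: "s > 0" "\<And>w. s * (w \<bullet> w) \<le> w \<bullet> (\<sigma> *v w)"
    using posdef_lower_bound[OF \<sigma>(2)] by blast
  have s': "s * (v \<bullet> v) \<le> v \<bullet> (?\<Sigma> *v v)" for v
    by (rule kron_mat_1_lower_bound[OF s(2)])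
  obtain M where M: "\<And>v. norm (?\<Sigma> *v v) \<le> M * norm v"
    using bounded_linear.pos_bounded[OF matrix_vector_mul_bounded_linear[of ?\<Sigma>]]
    by (metis mult.commute)
  obtain L where L: "\<And>v. norm (?K *v v) \<le> L * norm v" "L > 0"
    using bounded_linear.pos_bounded[OF matrix_vector_mul_bounded_linear[of ?K]]
    by (metis mult.commute)
  \<comment> \<open>Passing from an entrywise bound to a norm bound costs the product of the two
    matrix dimensions.\<close>
  define C' where "C' = real CARD('n \<times> 'n) * real CARD('n \<times> 'n) * C"
  have "0 \<le> C * \<gamma> ^ 0" by (rule order_trans[OF norm_ge_zero C])
  then have C'0: "C' \<ge> 0" by (simp add: C'_def)
  have close: "norm ((?\<rho> m - ?\<Sigma>) *v v) \<le> C' * \<gamma> ^ m * norm v" for m v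
    using norm_mult_vec_le_entries[OF C, of m v] by (simp add: C'_def mult.assoc)
  have "(\<lambda>m. C' * \<gamma> ^ m) \<longlonglongrightarrow> C' * 0"
    using \<gamma> by (intro tendsto_intros LIMSEQ_realpow_zero) auto
  then have "\<forall>\<^sub>F m in sequentially. C' * \<gamma> ^ m < s / 2"
    using s(1) by (intro order_tendstoD(2)[of _ 0]) auto
  then have ev: "\<forall>\<^sub>F m in sequentially. C' * \<gamma> ^ m \<le> s / 2"
    by (rule eventually_mono) simp
  note est = sqrt_sandwich_estimates[OF dagger_boundary_state inv s(1) s' M L(1) less_imp_le[OF L(2)] close]
  define b where "b = sqrt (M + s / 2) * L * sqrt (2 / s) * C'"
  have "\<forall>\<^sub>F m in sequentially. opnorm (mat_sqrt (?\<rho> m) ** ?K ** mat_sqrt (?\<rho> m) - mat 1) \<le> b * \<gamma> ^ m"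
    using ev
  proof (rule eventually_mono)
    fix m assume "C' * \<gamma> ^ m \<le> s / 2"
    then show "opnorm (mat_sqrt (?\<rho> m) ** ?K ** mat_sqrt (?\<rho> m) - mat 1) \<le> b * \<gamma> ^ m"
      using est(2)[of m] C'0 \<gamma>(1) by (simp add: b_def mult.assoc)
  qed
  then obtain c where c: "c > 0"
    "\<And>m. opnorm (mat_sqrt (?\<rho> m) ** ?K ** mat_sqrt (?\<rho> m) - mat 1) \<le> c * \<gamma> ^ m"
    by (rule eventually_geometric_bound_all[OF _ \<gamma>(1)]) blast
  \<comment> \<open>The summand 1 keeps \<open>c'\<close> positive when \<open>C'\<close> is
    zero.\<close>
  define c' where "c' = 2 / s * C' + 1"
  have c': "c' > 0" using s(1) C'0 by (simp add: c'_def add_nonneg_pos)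
  have second: "\<forall>\<^sub>F m in sequentially. invertible (mat_sqrt (?\<rho> m)) \<and>
     opnorm (matrix_inv (mat_sqrt (?\<rho> m)) ** ?\<Sigma> ** matrix_inv (mat_sqrt (?\<rho> m)) - mat 1) \<le> c' * \<gamma> ^ m"
    using ev
  proof (rule eventually_mono)
    fix m assume m: "C' * \<gamma> ^ m \<le> s / 2"
    have nn: "0 \<le> C' * \<gamma> ^ m" using C'0 \<gamma>(1) by simp
    have "2 / s * (C' * \<gamma> ^ m) \<le> c' * \<gamma> ^ m"
      using \<gamma>(1) by (simp add: c'_def distrib_right mult.assoc)
    then show "invertible (mat_sqrt (?\<rho> m)) \<and>
      opnorm (matrix_inv (mat_sqrt (?\<rho> m)) ** ?\<Sigma> ** matrix_inv (mat_sqrt (?\<rho> m)) - mat 1) \<le> c' * \<gamma> ^ m"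
      using est(1)[OF nn m] est(3)[OF nn m] by linarith
  qed
  \<comment> \<open>As \<open>\<sigma>\<close> is fixed, \<open>l\<close> is a single positive
    number; the witnesses \<open>c * l\<close> and \<open>c' * l\<close> cancel the factor
    \<open>inverse l\<close> of the claim.\<close>
  have cancel: "x * l * inverse l * y = x * y" for x y using l by simp
  show ?thesis
    by (rule exI[of _ S], rule exI[of _ \<sigma>], rule exI[of _ "c * l"], rule exI[of _ "c' * l"], rule exI[of _ \<gamma>])
      (use rep \<sigma> rank_invertible[OF \<sigma>inv] c c' \<gamma> l second in \<open>simp add: l_def[symmetric] cancel del: mult.assoc\<close>)
qed

end
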